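(* Let $\Omega$ be an open subset of $\mathbb{R}$ and let $p\in\mathbb{N}$, $p\ge 2$. Let $\mu$ be the measure on $\mathbb{R}$ equal to $p$ times the Lebesgue measure restricted to the set $\left[-\frac{1}{2p},\frac{1}{2p}\right]+\mathbb{Z}$. Then $\Omega$ tiles $\mathbb{R}$ by $\{0,1,\dots,p-1\}$ if and only if $\Omega$ is a spectral set with pair measure $\mu$, i.e. $(\Omega,\mu)$ is a spectral pair.
   Context: Tiling: for measurable $A,B\subseteq\mathbb{R}$ and a finite or countable set $\mathcal{T}\subset\mathbb{R}$, $A$ tiles $B$ by $\mathcal{T}$ if the translates $\{A+t: t\in\mathcal{T}\}$ form a partition of $B$ up to Lebesgue measure zero (pairwise intersections are null, and the union equals $B$ up to a null set). Fourier transform: for $f\in L^1(\mathbb{R})$, $\hat f(t)=\int_{\mathbb{R}} f(x)e^{-2\pi i t x}\,dx$, $t\in\mathbb{R}$. Functions on $\Omega$ are regarded as functions on $\mathbb{R}$ vanishing outside $\Omega$. Spectral pair: for a measurable $\Omega\subseteq\mathbb{R}$ and a positive Radon measure $\mu$ on $\mathbb{R}$, $(\Omega,\mu)$ is a spectral pair if (1) for each $f\in L^1(\Omega)\cap L^2(\Omega)$ the continuous function $\hat f$ satisfies $\int|\hat f|^2\,d\mu<\infty$; and (2) the mapping $f\mapsto\hat f$ from $L^1(\Omega)\cap L^2(\Omega)\subset L^2(\Omega)$ into $L^2(\mu)$ is isometric and has dense range. In this case $\Omega$ is called spectral and $\mu$ a pair measure (or dual measure) for $\Omega$. *)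

theory Defs
  imports "HOL-Analysis.Analysis"
begin

definition tiles :: "real set \<Rightarrow> real set \<Rightarrow> real set \<Rightarrow> bool" where
  "tiles A T B \<longleftrightarrow>
     A \<in> sets lebesgue \<and> B \<in> sets lebesgue \<and> countable T \<and>
     (\<forall>s\<in>T. \<forall>t\<in>T. s \<noteq> t \<longrightarrow> ((\<lambda>x. x + s) ` A) \<inter> ((\<lambda>x. x + t) ` A) \<in> null_sets lebesgue) \<and>
     sym_diff (\<Union>t\<in>T. (\<lambda>x. x + t) ` A) B \<in> null_sets lebesgue"

definition fourier :: "(real \<Rightarrow> complex) \<Rightarrow> real \<Rightarrow> complex" where
  "fourier f t = (LINT x|lebesgue. f x * exp (- 2 * of_real pi * \<i> * of_real t * of_real x))"

text \<open>The space \<open>L\<^sup>2(M)\<close> is represented by its functions rather than by classes modulo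
  equality almost everywhere, so \<open>L2_norm M\<close> is a seminorm; it is only meaningful on \<open>L2 M\<close>.\<close>

definition L2 :: "'a measure \<Rightarrow> ('a \<Rightarrow> complex) set" where
  "L2 M = {f \<in> borel_measurable M. integrable M (\<lambda>x. (cmod (f x))\<^sup>2)}"

definition L2_norm :: "'a measure \<Rightarrow> ('a \<Rightarrow> complex) \<Rightarrow> real" where
  "L2_norm M f = sqrt (LINT x|M. (cmod (f x))\<^sup>2)"

definition L1_L2_on :: "real set \<Rightarrow> (real \<Rightarrow> complex) set" where
  "L1_L2_on \<Omega> = {f. integrable lebesgue f \<and> f \<in> L2 lebesgue \<and> (\<forall>x. x \<notin> \<Omega> \<longrightarrow> f x = 0)}"

definition radon_measure :: "real measure \<Rightarrow> bool" where
  "radon_measure \<mu> \<longleftrightarrow>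
     sets \<mu> = sets borel \<and>
     (\<forall>K. compact K \<longrightarrow> emeasure \<mu> K < \<infinity>) \<and>
     (\<forall>B\<in>sets borel. emeasure \<mu> B = (SUP K\<in>{K. K \<subseteq> B \<and> compact K}. emeasure \<mu> K))"

text \<open>The Fourier transform is linear, so that it is isometric means that it preserves norms.\<close>

definition spectral_pair :: "real set \<Rightarrow> real measure \<Rightarrow> bool" where
  "spectral_pair \<Omega> \<mu> \<longleftrightarrow>
     \<Omega> \<in> sets lebesgue \<and> radon_measure \<mu> \<and>
     (\<forall>f\<in>L1_L2_on \<Omega>. fourier f \<in> L2 \<mu>) \<and>
     (\<forall>f\<in>L1_L2_on \<Omega>. L2_norm \<mu> (fourier f) = L2_norm lebesgue f) \<and>
     (\<forall>g\<in>L2 \<mu>. \<forall>\<epsilon>>0. \<exists>f\<in>L1_L2_on \<Omega>. L2_norm \<mu> (\<lambda>t. fourier f t - g t) < \<epsilon>)"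

text \<open>The sum of an interval and \<open>\<int>\<close> below is the Minkowski sum of sets of reals.\<close>

definition periodic_interval_measure :: "nat \<Rightarrow> real measure" where
  "periodic_interval_measure p =
     scale_measure (of_nat p)
       (density lborel (indicator ({- 1 / (2 * real p) .. 1 / (2 * real p)} + \<int>)))"

end

theory Submission
  imports Defs
begin

text \<open>
  The idea is to read everything on the fibres \<open>x + \<int>\<close> of the line. Write
  \<open>\<mu>\<close> for the measure and \<open>I\<close> for the interval of length \<open>1 /
  p\<close> centred at 0. Let \<open>F\<close> be the Fourier transform of \<open>f\<close>. For fixed
  \<open>t\<close> the numbers \<open>F (t + n)\<close>, \<open>n \<in> \<int>\<close>, are the Fourier
  coefficients of a function on the unit interval, so Parseval's identity gives
  (\<open>energy_fibre_formula\<close>) that \<open>\<integral>\<bar>F\<bar>\<^sup>2 d\<mu>\<close> is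
  the integral over \<open>x \<in> [0, 1)\<close> of the mean over \<open>t \<in> I\<close> of
  \<open>\<bar>\<Sum>m. f (x + m) exp (- 2 \<pi> \<i> m t)\<bar>\<^sup>2\<close>. The mean over
  \<open>I\<close> of \<open>exp (2 \<pi> \<i> d t)\<close> is \<open>sin (\<pi> d / p) / (\<pi> d /
  p)\<close>, which for \<open>d \<noteq> 0\<close> vanishes if and only if \<open>p\<close> divides
  \<open>d\<close>.

  Hence the transform is isometric on any Borel set whose fibres lie in residue classes modulo
  \<open>p\<close> (\<open>isometry\<close>). Conversely, if it is isometric on an open set, the fibres
  of that set must lie in residue classes (\<open>isometric_on_open_imp_residue_separated\<close>): two
  short intervals at an integer distance that is not divisible by \<open>p\<close> would produce a cross
  term.

  It remains to see that, for an open set \<open>\<Omega>\<close> with this property, dense range means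
  that almost every fibre is a whole residue class, that is, that \<open>\<Omega>\<close> tiles
  (\<open>tiles_interval_imp\<close>, \<open>complete_imp_tiles\<close>). If it is not,
  \<open>\<Omega>\<close> can be enlarged by a set of positive measure to a set on which the transform
  is still isometric; transforms of functions on the added part are orthogonal to the range
  (\<open>complete_imp_fibres_filled\<close>). If almost every fibre is a whole residue class, then the
  inverse transform of a function \<open>g\<close> on one component of the support of
  \<open>\<mu>\<close>, restricted to \<open>\<Omega>\<close>, has the same norm as \<open>g\<close>,
  because its values on a residue class modulo \<open>p\<close> are the Fourier coefficients of a
  modulation of \<open>g\<close> on an interval of length \<open>1 / p\<close>. So nothing of
  \<open>g\<close> is lost, and \<open>g\<close> is in the closure of the range
  (\<open>approximable_single_cell\<close>, \<open>full_fibres_imp_complete\<close>).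

  Only Parseval's identity for bounded functions on an interval is needed from Fourier analysis. It is
  derived from the Stone-Weierstrass theorem on the circle.
\<close>

section \<open>Complex exponentials and the transform\<close>

definition phase :: "real \<Rightarrow> complex" where
  "phase x = cis (2 * pi * x)"

text \<open>The transform is taken of Borel functions against \<^term>\<open>lborel\<close>, where Fubini's theorem and
  measurability in the parameter are available; \<open>fourier_eq_ft\<close> relates it to \<^const>\<open>fourier\<close>.\<close>

definition ft :: "(real \<Rightarrow> complex) \<Rightarrow> real \<Rightarrow> complex" where
  "ft f t = (LINT x|lborel. f x * phase (- (t * x)))"

text \<open>The squared \<open>L\<^sup>2\<close> norm, with values in \<^typ>\<open>ennreal\<close> so that it can be computed by Tonelli's
  theorem before it is known to be finite.\<close>

definition energy :: "'a measure \<Rightarrow> ('a \<Rightarrow> complex) \<Rightarrow> ennreal" where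
  "energy M f = (\<integral>\<^sup>+x. ennreal ((cmod (f x))\<^sup>2) \<partial>M)"

lemma norm_phase [simp]: "cmod (phase x) = 1"
  by (simp add: phase_def)

lemma phase_0 [simp]: "phase 0 = 1"
  by (simp add: phase_def)

lemma phase_add: "phase (x + y) = phase x * phase y"
  by (simp add: phase_def cis_mult distrib_left)

lemma phase_of_int [simp]: "phase (of_int n) = 1"
  unfolding phase_def using cis_multiple_2pi[of "of_int n"] by (simp add: mult.commute)

lemma cnj_phase [simp]: "cnj (phase x) = phase (- x)"
  by (simp add: phase_def cis_cnj)

lemma continuous_phase [continuous_intros]:
  "continuous_on S f \<Longrightarrow> continuous_on S (\<lambda>x. phase (f x))"
  unfolding phase_def by (intro continuous_intros)

lemma phase_borel [measurable]: "phase \<in> borel_measurable borel"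
  by (intro borel_measurable_continuous_onI continuous_intros)

lemma cnj_borel [measurable]: "cnj \<in> borel_measurable borel"
  by (intro borel_measurable_continuous_onI continuous_intros)

lemma cmod_diff_squared: "(cmod (a - b))\<^sup>2 = (cmod a)\<^sup>2 - 2 * Re (a * cnj b) + (cmod b)\<^sup>2"
  by (simp add: cmod_power2) (simp add: power2_eq_square algebra_simps)

section \<open>Trigonometric polynomials\<close>

definition trig_poly :: "(real \<Rightarrow> complex) \<Rightarrow> bool" where
  "trig_poly f \<longleftrightarrow> (\<exists>S a. finite S \<and> f = (\<lambda>x. \<Sum>n\<in>S. a n * phase (of_int n * x)))"

lemma trig_poly_add:
  assumes "trig_poly f" "trig_poly g"
  shows "trig_poly (\<lambda>x. f x + g x)"
proof -
  obtain S a where S: "finite S" "f = (\<lambda>x. \<Sum>n\<in>S. a n * phase (of_int n * x))"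
    using assms(1) unfolding trig_poly_def by blast
  obtain T b where T: "finite T" "g = (\<lambda>x. \<Sum>n\<in>T. b n * phase (of_int n * x))"
    using assms(2) unfolding trig_poly_def by blast
  define c where "c n = (if n \<in> S then a n else 0) + (if n \<in> T then b n else 0)" for n
  have "f x + g x = (\<Sum>n\<in>S \<union> T. c n * phase (of_int n * x))" for x
  proof -
    have "(\<Sum>n\<in>S. a n * phase (of_int n * x)) = (\<Sum>n\<in>S \<union> T. (if n \<in> S then a n else 0) * phase (of_int n * x))"
      using S T by (intro sum.mono_neutral_cong_left) auto
    moreover have "(\<Sum>n\<in>T. b n * phase (of_int n * x)) = (\<Sum>n\<in>S \<union> T. (if n \<in> T then b n else 0) * phase (of_int n * x))"
      using S T by (intro sum.mono_neutral_cong_left) auto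
    ultimately show ?thesis
      unfolding S T c_def by (simp add: sum.distrib distrib_right)
  qed
  then show ?thesis
    unfolding trig_poly_def using S T by (intro exI[of _ "S \<union> T"] exI[of _ c]) auto
qed

lemma trig_poly_monomial: "trig_poly (\<lambda>x. c * phase (of_int n * x))"
  unfolding trig_poly_def by (intro exI[of _ "{n}"] exI[of _ "\<lambda>_. c"]) auto

lemma trig_poly_const: "trig_poly (\<lambda>x. c)"
  using trig_poly_monomial[of c 0] by simp

lemma trig_poly_sum:
  "finite A \<Longrightarrow> (\<And>i. i \<in> A \<Longrightarrow> trig_poly (f i)) \<Longrightarrow> trig_poly (\<lambda>x. \<Sum>i\<in>A. f i x)"
  by (induction A rule: finite_induct) (auto intro: trig_poly_const trig_poly_add)

lemma trig_poly_mult: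
  assumes "trig_poly f" "trig_poly g"
  shows "trig_poly (\<lambda>x. f x * g x)"
proof -
  obtain S a where S: "finite S" "f = (\<lambda>x. \<Sum>n\<in>S. a n * phase (of_int n * x))"
    using assms(1) unfolding trig_poly_def by blast
  obtain T b where T: "finite T" "g = (\<lambda>x. \<Sum>n\<in>T. b n * phase (of_int n * x))"
    using assms(2) unfolding trig_poly_def by blast
  have "f x * g x = (\<Sum>n\<in>S. \<Sum>m\<in>T. (a n * b m) * phase (of_int (n + m) * x))" for x
    unfolding S T by (simp add: sum_product phase_add distrib_right distrib_left mult_ac)
  then have "(\<lambda>x. f x * g x) = (\<lambda>x. \<Sum>n\<in>S. \<Sum>m\<in>T. (a n * b m) * phase (of_int (n + m) * x))"
    by blast
  moreover have "trig_poly \<dots>"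
    using S(1) T(1) by (intro trig_poly_sum trig_poly_monomial)
  ultimately show ?thesis by simp
qed

text \<open>On the unit circle the real and imaginary parts are themselves combinations of
  \<open>phase x\<close> and \<open>phase (- x)\<close>, and trigonometric polynomials are closed under sums and products.\<close>

lemma trig_poly_real_polynomial_function:
  assumes "real_polynomial_function q"
  shows "trig_poly (\<lambda>x. of_real (q (phase x)))"
  using assms
proof (induction q rule: real_polynomial_function.induct)
  case (linear h)
  interpret bounded_linear h by fact
  have *: "of_real (h (phase x)) =
     (of_real (h 1) / 2 + of_real (h \<i>) / (2 * \<i>)) * phase (of_int 1 * x) +
     (of_real (h 1) / 2 - of_real (h \<i>) / (2 * \<i>)) * phase (of_int (- 1) * x)" for x
  proof -
    have "phase x = cos (2 * pi * x) *\<^sub>R 1 + sin (2 * pi * x) *\<^sub>R \<i>"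
      by (simp add: phase_def complex_eq_iff)
    then have "h (phase x) = cos (2 * pi * x) * h 1 + sin (2 * pi * x) * h \<i>"
      by (simp add: add scaleR)
    then show ?thesis
      by (simp add: phase_def complex_eq_iff field_simps)
  qed
  show ?case
    by (subst *) (intro trig_poly_add trig_poly_monomial)
next
  case (const c)
  then show ?case by (rule trig_poly_const)
next
  case (add f g)
  then show ?case using trig_poly_add by simp
next
  case (mult f g)
  then show ?case using trig_poly_mult by simp
qed

text \<open>A function on the unit interval with equal end values is a continuous function on the unit
  circle, so the Stone-Weierstrass theorem on the circle applies to it.\<close>

lemma trig_poly_uniform_approx:
  fixes f :: "real \<Rightarrow> complex"
  assumes f: "continuous_on {0..1} f" and loop: "f 0 = f 1" and "\<epsilon> > 0"
  shows "\<exists>q. trig_poly q \<and> (\<forall>x\<in>{0..1}. cmod (f x - q x) < \<epsilon>)"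
proof -
  \<comment> \<open>The continuity of the induced function on the circle is that of the circle map of a loop.\<close>
  have "homotopic_loops UNIV f f"
    using f loop by (simp add: homotopic_loops_refl path_def pathstart_def pathfinish_def)
  then have "continuous_on (sphere 0 1) (f \<circ> (\<lambda>z. Arg2pi z / (2 * pi)))"
    using homotopic_loops_imp_homotopic_circlemaps homotopic_with_imp_continuous by blast
  from Stone_Weierstrass_polynomial_function[OF compact_sphere this \<open>\<epsilon> > 0\<close>]
  obtain g where g: "polynomial_function g"
    "\<forall>z \<in> sphere 0 1. norm ((f \<circ> (\<lambda>z. Arg2pi z / (2 * pi))) z - g z) < \<epsilon>"
    by (elim exE conjE)
  have "real_polynomial_function (Re \<circ> g)" "real_polynomial_function (Im \<circ> g)"
    using g(1)[unfolded polynomial_function_def, rule_format, OF bounded_linear_Re]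
      g(1)[unfolded polynomial_function_def, rule_format, OF bounded_linear_Im] .
  note q = this[THEN trig_poly_real_polynomial_function]
  have "trig_poly (\<lambda>x. of_real ((Re \<circ> g) (phase x)) + \<i> * of_real ((Im \<circ> g) (phase x)))"
    by (rule trig_poly_add[OF q(1) trig_poly_mult[OF trig_poly_const q(2)]])
  moreover have "of_real ((Re \<circ> g) (phase x)) + \<i> * of_real ((Im \<circ> g) (phase x)) = g (phase x)" for x
    by (simp add: complex_eq_iff)
  ultimately have "trig_poly (\<lambda>x. g (phase x))"
    by simp
  moreover have "cmod (f x - g (phase x)) < \<epsilon>" if x: "x \<in> {0..1}" for x
  proof -
    have "f (Arg2pi (phase x) / (2 * pi)) = f x"
    proof (cases "x = 1")
      case True
      then show ?thesis using phase_of_int[of 1] loop by (simp add: Arg2pi_of_real[of 1, simplified])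
    next
      case False
      then have "Arg2pi (phase x) = 2 * pi * x"
        using x by (intro Arg2pi_unique[of 1]) (auto simp: phase_def cis_conv_exp)
      then show ?thesis by simp
    qed
    then show ?thesis using g(2)[rule_format, of "phase x"] by simp
  qed
  ultimately show ?thesis by (intro exI[of _ "\<lambda>x. g (phase x)"]) simp
qed

section \<open>Bounded functions of bounded support\<close>

text \<open>On this class every product is integrable and every fibre \<open>x + \<int>\<close> meets the support in
  finitely many points, so that the sums over fibres below are finite sums.\<close>

definition bounded_supported :: "(real \<Rightarrow> complex) \<Rightarrow> bool" where
  "bounded_supported f \<longleftrightarrow>
     f \<in> borel_measurable borel \<and> (\<exists>B. \<forall>x. cmod (f x) \<le> B) \<and> (\<exists>R. \<forall>x. f x \<noteq> 0 \<longrightarrow> \<bar>x\<bar> \<le> R)"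

lemma bounded_supportedI:
  assumes "f \<in> borel_measurable borel" "\<And>x. cmod (f x) \<le> B" "\<And>x. f x \<noteq> 0 \<Longrightarrow> \<bar>x\<bar> \<le> R"
  shows "bounded_supported f"
  using assms unfolding bounded_supported_def by blast

lemma bounded_supported_borel [measurable_dest]:
  "bounded_supported f \<Longrightarrow> f \<in> borel_measurable borel"
  unfolding bounded_supported_def by blast

lemma bounded_supported_mult:
  assumes f: "bounded_supported f" and h: "h \<in> borel_measurable borel" "\<And>x. cmod (h x) \<le> C"
  shows "bounded_supported (\<lambda>x. f x * h x)"
proof -
  obtain B R where B: "\<And>x. cmod (f x) \<le> B" and R: "\<And>x. f x \<noteq> 0 \<Longrightarrow> \<bar>x\<bar> \<le> R"
    using f unfolding bounded_supported_def by blast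
  have "cmod (f x * h x) \<le> B * C" for x
    using B[of x] h(2)[of x] by (simp add: norm_mult mult_mono order_trans[OF norm_ge_zero])
  then show ?thesis
    using h(1) R bounded_supported_borel[OF f] by (intro bounded_supportedI[where B = "B * C" and R = R]) auto
qed

lemma bounded_supported_phase:
  "bounded_supported f \<Longrightarrow> bounded_supported (\<lambda>x. f x * phase (c * x))"
  by (rule bounded_supported_mult[where C = 1]) simp_all

lemma bounded_supported_indicator:
  "bounded_supported f \<Longrightarrow> A \<in> sets borel \<Longrightarrow> bounded_supported (\<lambda>x. f x * indicator A x)"
  by (rule bounded_supported_mult[where C = 1]) (auto simp: indicator_def)

lemma bounded_supported_cnj:
  "bounded_supported f \<Longrightarrow> bounded_supported (\<lambda>x. cnj (f x))"
  unfolding bounded_supported_def by (auto simp: bounded_linear_cnj borel_measurable_continuous_onI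
    intro!: measurable_compose[OF _ borel_measurable_continuous_onI[of cnj]] continuous_intros)

lemma bounded_supported_mult_bounded_supported:
  assumes "bounded_supported f" "bounded_supported g"
  shows "bounded_supported (\<lambda>x. f x * g x)"
proof -
  obtain C where "\<And>x. cmod (g x) \<le> C"
    using assms(2) unfolding bounded_supported_def by blast
  with assms(1) bounded_supported_borel[OF assms(2)] show ?thesis
    by (rule bounded_supported_mult)
qed

lemma bounded_supported_add:
  assumes f: "bounded_supported f" and g: "bounded_supported g"
  shows "bounded_supported (\<lambda>x. f x + g x)"
proof -
  obtain B R where B: "\<And>x. cmod (f x) \<le> B" and R: "\<And>x. f x \<noteq> 0 \<Longrightarrow> \<bar>x\<bar> \<le> R"
    using f unfolding bounded_supported_def by blast
  obtain B' R' where B': "\<And>x. cmod (g x) \<le> B'" and R': "\<And>x. g x \<noteq> 0 \<Longrightarrow> \<bar>x\<bar> \<le> R'"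
    using g unfolding bounded_supported_def by blast
  have "cmod (f x + g x) \<le> B + B'" for x
    using B[of x] B'[of x] norm_triangle_ineq[of "f x" "g x"] by simp
  moreover have "\<bar>x\<bar> \<le> max R R'" if "f x + g x \<noteq> 0" for x
    using that R[of x] R'[of x] by (cases "f x = 0") auto
  ultimately show ?thesis
    using bounded_supported_borel[OF f] bounded_supported_borel[OF g] by (intro bounded_supportedI) auto
qed

lemma bounded_supported_zero: "bounded_supported (\<lambda>x. 0)"
  by (rule bounded_supportedI) auto

lemma bounded_supported_cmult: "bounded_supported f \<Longrightarrow> bounded_supported (\<lambda>x. c * f x)"
  using bounded_supported_mult[of f "\<lambda>_. c" "cmod c"] by (simp add: mult.commute)

lemma bounded_supported_sum:
  "finite A \<Longrightarrow> (\<And>i. i \<in> A \<Longrightarrow> bounded_supported (f i)) \<Longrightarrow> bounded_supported (\<lambda>x. \<Sum>i\<in>A. f i x)"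
  by (induction A rule: finite_induct) (auto intro: bounded_supported_zero bounded_supported_add)

lemma bounded_supported_affine:
  assumes "bounded_supported f" "c \<noteq> 0"
  shows "bounded_supported (\<lambda>x. f (t + c * x))"
proof -
  obtain B R where B: "\<And>x. cmod (f x) \<le> B" and R: "\<And>x. f x \<noteq> 0 \<Longrightarrow> \<bar>x\<bar> \<le> R"
    using assms unfolding bounded_supported_def by blast
  have "\<bar>x\<bar> \<le> (R + \<bar>t\<bar>) / \<bar>c\<bar>" if "f (t + c * x) \<noteq> 0" for x
  proof -
    have "\<bar>c * x\<bar> \<le> R + \<bar>t\<bar>" using R[OF that] by linarith
    then show ?thesis using assms(2) by (simp add: field_simps abs_mult)
  qed
  then show ?thesis
    using B bounded_supported_borel[OF assms(1)] by (intro bounded_supportedI[where B = B]) auto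
qed

lemma bounded_supported_indicator_Icc: "bounded_supported (indicator {a..b})"
  by (rule bounded_supportedI[where B = 1 and R = "max \<bar>a\<bar> \<bar>b\<bar>"]) (auto simp: indicator_def)

lemma bounded_supported_integrable:
  assumes f: "bounded_supported f"
  shows "integrable lborel f"
proof -
  obtain B R where B: "\<And>x. cmod (f x) \<le> B" and R: "\<And>x. f x \<noteq> 0 \<Longrightarrow> \<bar>x\<bar> \<le> R"
    using f unfolding bounded_supported_def by blast
  have i: "integrable lborel (\<lambda>x. B * indicator {-R..R} x :: real)"
    by (auto intro!: integrable_mult_right integrable_real_indicator simp: emeasure_lborel_Icc_eq)
  show ?thesis
    using bounded_supported_borel[OF f] B R
    by (intro Bochner_Integration.integrable_bound[OF i])
       (fastforce intro!: AE_I2 simp: indicator_def abs_le_iff order_trans[OF _ abs_ge_self])+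
qed

lemma bounded_supported_integrable_mult:
  "bounded_supported f \<Longrightarrow> bounded_supported g \<Longrightarrow> integrable lborel (\<lambda>x. f x * g x)"
  by (intro bounded_supported_integrable bounded_supported_mult_bounded_supported)

lemma bounded_supported_integrable_square:
  assumes "bounded_supported f"
  shows "integrable lborel (\<lambda>x. (cmod (f x))\<^sup>2)"
proof -
  have "integrable lborel (\<lambda>x. norm (f x * f x))"
    by (intro integrable_norm bounded_supported_integrable_mult assms)
  then show ?thesis by (simp add: norm_mult power2_eq_square)
qed

lemma energy_eq_integral:
  assumes "integrable M (\<lambda>x. (cmod (f x))\<^sup>2)"
  shows "energy M f = ennreal (LINT x|M. (cmod (f x))\<^sup>2)"
  unfolding energy_def using assms by (rule nn_integral_eq_integral) simp

lemma integral_cmod_squared: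
  assumes "bounded_supported f"
  shows "of_real (LINT x|lborel. (cmod (f x))\<^sup>2) = (LINT x|lborel. f x * cnj (f x))"
  unfolding integral_complex_of_real[symmetric] complex_norm_square ..

lemma integral_cmod_diff_squared:
  assumes "integrable M (\<lambda>x. (cmod (f x))\<^sup>2)" "integrable M (\<lambda>x. f x * cnj (g x))"
    "integrable M (\<lambda>x. (cmod (g x))\<^sup>2)"
  shows "(LINT x|M. (cmod (f x - g x))\<^sup>2) =
    (LINT x|M. (cmod (f x))\<^sup>2) - 2 * Re (LINT x|M. f x * cnj (g x)) + (LINT x|M. (cmod (g x))\<^sup>2)"
proof -
  define r where "r x = Re (f x * cnj (g x))" for x
  have r: "integrable M r" "Re (LINT x|M. f x * cnj (g x)) = integral\<^sup>L M r"
    unfolding r_def using assms(2) by (rule integrable_Re) (simp only: integral_Re[OF assms(2)])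
  show ?thesis
    unfolding cmod_diff_squared r(2) r_def[symmetric] using assms(1,3) r(1) by simp
qed

section \<open>Mean-square density of trigonometric polynomials\<close>

lemma trig_poly_continuous: "trig_poly q \<Longrightarrow> continuous_on UNIV q"
  unfolding trig_poly_def by (auto intro!: continuous_intros)

text \<open>A bounded Borel function is an almost everywhere limit of continuous functions. Cutting these
  off near the end points makes them loops, and clamping them to the bound of \<open>f\<close> makes dominated
  convergence applicable.\<close>

lemma trig_poly_L2_approx:
  fixes f :: "real \<Rightarrow> complex"
  assumes f: "f \<in> borel_measurable borel" and B: "\<And>x. cmod (f x) \<le> B" and "\<epsilon> > 0"
  shows "\<exists>q. trig_poly q \<and> (LINT x|lborel. indicator {0..1} x * (cmod (f x - q x))\<^sup>2) < \<epsilon>"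
proof -
  have B0: "0 \<le> B" using B[of 0] norm_ge_zero[of "f 0"] by linarith
  have "f measurable_on UNIV"
    using f by (intro lebesgue_measurable_imp_measurable_on) (auto intro: measurable_completion)
  then obtain N g where N: "negligible N" and g: "\<And>n. continuous_on UNIV (g n)"
    and lim: "\<And>x. x \<notin> N \<Longrightarrow> (\<lambda>n. g n x) \<longlonglongrightarrow> f x"
    unfolding measurable_on_def by auto
  \<comment> \<open>\<open>w k\<close> is a trapezoidal cut-off with limit 1 in the open unit interval.\<close>
  define w where "w k x = max 0 (min 1 (min (real k * x) (real k * (1 - x))))" for k x
  \<comment> \<open>The projection onto the disc of radius \<open>B\<close> fixes the values of \<open>f\<close>.\<close>
  define c where "c z = closest_point (cball 0 B) z" for z :: complex
  define h where "h k x = of_real (w k x) * c (g k x)" for k x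
  have w: "0 \<le> w k x" "w k x \<le> 1" "w k 0 = 0" "w k 1 = 0" for k x
    by (auto simp: w_def)
  have c_cont: "continuous_on UNIV c"
    unfolding c_def using B0 by (intro continuous_on_closest_point) auto
  have c_le: "cmod (c z) \<le> B" for z
    using closest_point_in_set[of "cball 0 B" z] B0 by (simp add: c_def)
  have c_f: "c (f x) = f x" for x
    unfolding c_def using B[of x] by (intro closest_point_self) simp
  have w_cont: "continuous_on UNIV (w k)" for k
    unfolding w_def by (intro continuous_intros)
  have h_cont: "continuous_on UNIV (h k)" for k
    unfolding h_def by (intro continuous_intros w_cont continuous_on_compose2[OF c_cont g]) auto
  have h_le: "cmod (h k x) \<le> B" for k x
    using mult_mono[OF w(2)[of k x] c_le[of "g k x"]] w(1)[of k x] by (simp add: h_def norm_mult)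
  have [measurable]: "h k \<in> borel_measurable borel" for k
    by (intro borel_measurable_continuous_onI h_cont)
  note f[measurable]
  have h_lim: "(\<lambda>k. h k x) \<longlonglongrightarrow> f x" if x: "x \<notin> N" "0 < x" "x < 1" for x
  proof -
    have "\<forall>\<^sub>F k in sequentially. w k x = 1"
    proof -
      obtain K where K: "1 / x \<le> real K" "1 / (1 - x) \<le> real K"
        by (metis max.bounded_iff real_arch_simple)
      have "w k x = 1" if "k \<ge> K" for k
      proof -
        have "1 / x \<le> real k" "1 / (1 - x) \<le> real k" using K that by linarith+
        then show ?thesis using x by (simp add: w_def field_simps)
      qed
      then show ?thesis unfolding eventually_sequentially by blast
    qed
    then have "(\<lambda>k. w k x) \<longlonglongrightarrow> 1"
      by (rule tendsto_eventually)
    moreover have "(\<lambda>k. c (g k x)) \<longlonglongrightarrow> c (f x)"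
      using continuous_on_tendsto_compose[OF c_cont lim[OF x(1)]] by simp
    ultimately show ?thesis
      unfolding h_def using tendsto_mult[OF tendsto_of_real] c_f by fastforce
  qed
  have AEN: "AE x in lborel. x \<notin> N \<union> {0, 1}"
  proof -
    have "N \<union> {0, 1} \<in> null_sets lebesgue"
      using N by (simp add: negligible_iff_null_sets[symmetric])
    then have "AE x in lebesgue. x \<notin> N \<union> {0, 1}" by (rule AE_not_in)
    then show ?thesis by (simp only: AE_completion_iff)
  qed
  have "(\<lambda>k. LINT x|lborel. indicator {0..1} x * (cmod (f x - h k x))\<^sup>2) \<longlonglongrightarrow> (LINT x::real|lborel. (0::real))"
  proof (rule integral_dominated_convergence)
    show "integrable lborel (\<lambda>x. indicator {0..1::real} x * (2 * B)\<^sup>2)"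
      by (auto intro!: integrable_mult_left integrable_real_indicator)
    show "AE x in lborel. (\<lambda>k. indicator {0..1} x * (cmod (f x - h k x))\<^sup>2) \<longlonglongrightarrow> 0"
      using AEN
    proof eventually_elim
      case (elim x)
      show ?case
      proof (cases "x \<in> {0..1}")
        case True
        then have "(\<lambda>k. h k x) \<longlonglongrightarrow> f x" using elim by (intro h_lim) auto
        then have "(\<lambda>k. 1 * (cmod (f x - h k x))\<^sup>2) \<longlonglongrightarrow> 1 * (cmod (f x - f x))\<^sup>2"
          by (intro tendsto_intros)
        then show ?thesis using True by simp
      qed simp
    qed
    fix k
    show "AE x in lborel. norm (indicator {0..1} x * (cmod (f x - h k x))\<^sup>2) \<le> indicator {0..1} x * (2 * B)\<^sup>2"
    proof (rule AE_I2)
      fix x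
      have "cmod (f x - h k x) \<le> 2 * B"
        using norm_triangle_ineq4[of "f x" "h k x"] B[of x] h_le[of k x] by linarith
      then have "(cmod (f x - h k x))\<^sup>2 \<le> (2 * B)\<^sup>2" by (intro power_mono) auto
      then show "norm (indicator {0..1} x * (cmod (f x - h k x))\<^sup>2) \<le> indicator {0..1} x * (2 * B)\<^sup>2"
        by (auto simp: indicator_def)
    qed
  qed simp_all
  then have "\<forall>\<^sub>F k in sequentially. (LINT x|lborel. indicator {0..1} x * (cmod (f x - h k x))\<^sup>2) < \<epsilon> / 4"
    using \<open>\<epsilon> > 0\<close> by (intro order_tendstoD(2)) auto
  then obtain k where k: "(LINT x|lborel. indicator {0..1} x * (cmod (f x - h k x))\<^sup>2) < \<epsilon> / 4"
    by (auto simp: eventually_sequentially)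
  define \<delta> where "\<delta> = sqrt (\<epsilon> / 4)"
  have \<delta>: "\<delta> > 0" "\<delta>\<^sup>2 = \<epsilon> / 4" using \<open>\<epsilon> > 0\<close> by (simp_all add: \<delta>_def)
  have "h k 0 = h k 1" using w by (simp add: h_def)
  from trig_poly_uniform_approx[OF continuous_on_subset[OF h_cont[of k] subset_UNIV] this \<delta>(1)]
  obtain q where q: "trig_poly q" "\<forall>x\<in>{0..1}. cmod (h k x - q x) < \<delta>"
    by (elim exE conjE)
  have [measurable]: "q \<in> borel_measurable borel"
    by (intro borel_measurable_continuous_onI trig_poly_continuous q)
  have bs: "bounded_supported (\<lambda>x. indicator {0..1} x * (f x - h k x))"
  proof (rule bounded_supportedI[where B = "2 * B" and R = 1])
    show "cmod (indicator {0..1} x * (f x - h k x)) \<le> 2 * B" for x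
      using norm_triangle_ineq4[of "f x" "h k x"] B[of x] h_le[of k x] B0 by (auto simp: indicator_def)
  qed (auto simp: indicator_def)
  have int1: "integrable lborel (\<lambda>x. indicator {0..1} x * (cmod (f x - h k x))\<^sup>2)"
    using bounded_supported_integrable_square[OF bs]
    by (rule Bochner_Integration.integrable_cong[THEN iffD1, rotated -1]) (auto simp: indicator_def)
  have "(LINT x|lborel. indicator {0..1} x * (cmod (f x - q x))\<^sup>2)
     \<le> (LINT x|lborel. 2 * (indicator {0..1} x * (cmod (f x - h k x))\<^sup>2) + 2 * \<delta>\<^sup>2 * indicator {0..1} x)"
  proof (rule integral_mono')
    show "integrable lborel (\<lambda>x. 2 * (indicator {0..1} x * (cmod (f x - h k x))\<^sup>2) + 2 * \<delta>\<^sup>2 * indicator {0..1} x)"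
      by (intro Bochner_Integration.integrable_add integrable_mult_right int1 integrable_real_indicator) auto
    fix x :: real
    show "indicator {0..1} x * (cmod (f x - q x))\<^sup>2
        \<le> 2 * (indicator {0..1} x * (cmod (f x - h k x))\<^sup>2) + 2 * \<delta>\<^sup>2 * indicator {0..1} x"
    proof (cases "x \<in> {0..1}")
      case True
      have "cmod (f x - q x) \<le> cmod (f x - h k x) + \<delta>"
        using norm_triangle_ineq[of "f x - h k x" "h k x - q x"] bspec[OF q(2) True] by simp
      then have "(cmod (f x - q x))\<^sup>2 \<le> (cmod (f x - h k x) + \<delta>)\<^sup>2" by (intro power_mono) auto
      also have "\<dots> \<le> 2 * (cmod (f x - h k x))\<^sup>2 + 2 * \<delta>\<^sup>2"
        using sum_squares_bound[of "cmod (f x - h k x)" \<delta>] by (simp add: power2_sum)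
      finally show ?thesis using True by simp
    qed simp
  qed (auto simp: indicator_def)
  also have "\<dots> = 2 * (LINT x|lborel. indicator {0..1} x * (cmod (f x - h k x))\<^sup>2) + 2 * \<delta>\<^sup>2"
    by (subst Bochner_Integration.integral_add)
       (auto intro!: integrable_mult_right int1 integrable_real_indicator)
  also have "\<dots> < \<epsilon>" using k \<delta> by simp
  finally show ?thesis using q(1) by blast
qed

section \<open>Parseval's identity\<close>

lemma integral_phase_Icc:
  assumes "d \<noteq> 0" "a \<le> b"
  shows "(LINT x|lborel. indicator {a..b} x * phase (d * x)) =
         (phase (d * b) - phase (d * a)) / (2 * of_real pi * \<i> * of_real d)"
proof -
  have "(LINT x|lborel. indicator {a..b} x *\<^sub>R phase (d * x)) =
      phase (d * b) / (2 * of_real pi * \<i> * of_real d) - phase (d * a) / (2 * of_real pi * \<i> * of_real d)"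
  proof (rule integral_FTC_Icc[OF assms(2)])
    fix x
    show "((\<lambda>x. phase (d * x) / (2 * of_real pi * \<i> * of_real d)) has_vector_derivative phase (d * x))
        (at x within {a..b})"
    proof -
      let ?c = "2 * of_real pi * \<i> * complex_of_real d"
      have "((\<lambda>z. exp (?c * z) / ?c) has_field_derivative exp (?c * of_real x)) (at (of_real x))"
        using assms(1) by (auto intro!: derivative_eq_intros)
      then have "((\<lambda>x. exp (?c * of_real x) / ?c) has_vector_derivative exp (?c * of_real x)) (at x within {a..b})"
        by (rule has_vector_derivative_real_field)
      moreover have "phase (d * x) = exp (?c * of_real x)" for x
        by (simp add: phase_def cis_conv_exp mult_ac)
      ultimately show ?thesis by simp
    qed
  qed (intro continuous_intros)
  moreover have "indicator {a..b} x *\<^sub>R phase (d * x) = indicator {a..b} x * phase (d * x)" for x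
    by (simp add: indicator_def)
  ultimately show ?thesis by (simp add: diff_divide_distrib)
qed

lemma nn_integral_int_bound:
  fixes u :: "int \<Rightarrow> ennreal"
  assumes "\<And>S. finite S \<Longrightarrow> (\<Sum>n\<in>S. u n) \<le> c"
  shows "(\<integral>\<^sup>+n. u n \<partial>count_space UNIV) \<le> c"
proof -
  have "(\<integral>\<^sup>+n. u n \<partial>count_space UNIV) = (\<integral>\<^sup>+k. u (int_decode k) \<partial>count_space UNIV)"
    by (rule nn_integral_bij_count_space[symmetric]) (rule bij_int_decode)
  also have "\<dots> = (\<Sum>k. u (int_decode k))"
    by (rule nn_integral_count_space_nat)
  also have "\<dots> \<le> c"
  proof (rule suminf_le_const)
    fix n
    have "(\<Sum>k<n. u (int_decode k)) = (\<Sum>m\<in>int_decode ` {..<n}. u m)"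
      by (subst sum.reindex) (auto intro: inj_int_decode)
    also have "\<dots> \<le> c" by (intro assms) auto
    finally show "(\<Sum>k<n. u (int_decode k)) \<le> c" .
  qed simp
  finally show ?thesis .
qed

lemma sum_le_nn_integral_int:
  fixes u :: "int \<Rightarrow> ennreal"
  assumes "finite S"
  shows "(\<Sum>n\<in>S. u n) \<le> (\<integral>\<^sup>+n. u n \<partial>count_space UNIV)"
proof -
  have "(\<Sum>n\<in>S. u n) = (\<integral>\<^sup>+n. u n * indicator S n \<partial>count_space UNIV)"
    using assms by (subst nn_integral_count_space_indicator[symmetric]) (simp_all add: nn_integral_count_space_finite)
  also have "\<dots> \<le> (\<integral>\<^sup>+n. u n \<partial>count_space UNIV)"
    by (intro nn_integral_mono) (auto simp: indicator_def)
  finally show ?thesis .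
qed

text \<open>Pythagoras: the Fourier coefficients give the best mean-square approximation among trigonometric
  polynomials with frequencies in \<open>S\<close>. The choice of these coefficients for \<open>a\<close> yields Bessel's
  inequality; an arbitrary good approximation yields the converse.\<close>

lemma best_approximation:
  fixes f :: "real \<Rightarrow> complex" and S :: "int set"
  assumes f: "bounded_supported f" and supp: "\<And>x. x \<notin> {0..1} \<Longrightarrow> f x = 0" and S: "finite S"
  shows "(LINT x|lborel. indicator {0..1} x * (cmod (f x - (\<Sum>n\<in>S. a n * phase (of_int n * x))))\<^sup>2) =
    (LINT x|lborel. (cmod (f x))\<^sup>2) - (\<Sum>n\<in>S. (cmod (ft f (of_int n)))\<^sup>2)
     + (\<Sum>n\<in>S. (cmod (a n - ft f (of_int n)))\<^sup>2)"
proof -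
  define E where "E n x = (indicator {0..1} x * phase (of_int n * x) :: complex)" for n :: int and x :: real
  define P where "P x = (\<Sum>n\<in>S. a n * E n x)" for x
  define c where "c n = ft f (of_int n)" for n :: int
  have bE: "bounded_supported (E n)" for n
    unfolding E_def by (intro bounded_supported_phase bounded_supported_indicator_Icc)
  have bP: "bounded_supported P"
    unfolding P_def by (intro bounded_supported_sum bounded_supported_cmult bE S)
  have cn: "(LINT x|lborel. f x * cnj (E n x)) = c n" for n
    unfolding c_def ft_def E_def using supp by (intro Bochner_Integration.integral_cong) (auto simp: indicator_def)
  have orth: "(LINT x|lborel. E n x * cnj (E m x)) = (if n = m then 1 else 0)" for n m
  proof -
    have "E n x * cnj (E m x) = indicator {0..1} x * phase (of_int (n - m) * x)" for x
      by (auto simp: E_def indicator_def algebra_simps simp flip: phase_add)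
    then have "(LINT x|lborel. E n x * cnj (E m x)) = (LINT x|lborel. indicator {0..1} x * phase (of_int (n - m) * x))"
      by simp
    also have "\<dots> = (if n = m then 1 else 0)"
    proof (cases "n = m")
      case True
      have "(LINT x|lborel. of_real (indicator {0..1::real} x)) = complex_of_real (LINT x|lborel. indicator {0..1::real} x)"
        by (rule integral_complex_of_real)
      moreover have "of_real (indicator {0..1} x) = (indicator {0..1} x :: complex)" for x :: real
        by (simp add: indicator_def)
      ultimately show ?thesis using True by simp
    next
      case False
      then show ?thesis
        using integral_phase_Icc[of "of_int (n - m)" 0 1] phase_of_int[of "n - m"] by simp
    qed
    finally show ?thesis .
  qed
  have fP: "(LINT x|lborel. f x * cnj (P x)) = (\<Sum>n\<in>S. cnj (a n) * c n)"
  proof -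
    have "(LINT x|lborel. f x * cnj (P x)) = (LINT x|lborel. (\<Sum>n\<in>S. cnj (a n) * (f x * cnj (E n x))))"
      by (simp add: P_def sum_distrib_left mult_ac)
    also have "\<dots> = (\<Sum>n\<in>S. (LINT x|lborel. cnj (a n) * (f x * cnj (E n x))))"
      by (intro Bochner_Integration.integral_sum integrable_mult_right bounded_supported_integrable_mult f
          bounded_supported_cnj bE)
    finally show ?thesis by (simp add: cn)
  qed
  have EP: "(LINT x|lborel. E n x * cnj (P x)) = cnj (a n)" if "n \<in> S" for n
  proof -
    have "(LINT x|lborel. E n x * cnj (P x)) = (LINT x|lborel. (\<Sum>m\<in>S. cnj (a m) * (E n x * cnj (E m x))))"
      by (simp add: P_def sum_distrib_left mult_ac)
    also have "\<dots> = (\<Sum>m\<in>S. (LINT x|lborel. cnj (a m) * (E n x * cnj (E m x))))"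
      by (intro Bochner_Integration.integral_sum integrable_mult_right bounded_supported_integrable_mult
          bounded_supported_cnj bE)
    also have "\<dots> = (\<Sum>m\<in>S. cnj (a m) * (if n = m then 1 else 0))"
      by (simp add: orth)
    also have "\<dots> = cnj (a n)" using that S by (simp add: if_distrib cong: if_cong)
    finally show ?thesis .
  qed
  have PP: "(LINT x|lborel. P x * cnj (P x)) = (\<Sum>n\<in>S. a n * cnj (a n))"
  proof -
    have "(LINT x|lborel. P x * cnj (P x)) = (LINT x|lborel. (\<Sum>n\<in>S. a n * (E n x * cnj (P x))))"
      by (subst (1) P_def) (simp add: sum_distrib_right sum_distrib_left mult_ac)
    also have "\<dots> = (\<Sum>n\<in>S. (LINT x|lborel. a n * (E n x * cnj (P x))))"
      by (intro Bochner_Integration.integral_sum integrable_mult_right bounded_supported_integrable_mult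
          bounded_supported_cnj bE bP)
    finally show ?thesis by (simp add: EP)
  qed
  have i1: "integrable lborel (\<lambda>x. (cmod (f x))\<^sup>2)" "integrable lborel (\<lambda>x. (cmod (P x))\<^sup>2)"
     "integrable lborel (\<lambda>x. f x * cnj (P x))"
    by (intro bounded_supported_integrable_square bounded_supported_integrable_mult bounded_supported_cnj f bP)+
  have "(LINT x|lborel. indicator {0..1} x * (cmod (f x - (\<Sum>n\<in>S. a n * phase (of_int n * x))))\<^sup>2)
      = (LINT x|lborel. (cmod (f x - P x))\<^sup>2)"
    using supp by (intro Bochner_Integration.integral_cong) (auto simp: P_def E_def indicator_def)
  also have "\<dots> = (LINT x|lborel. (cmod (f x))\<^sup>2) - 2 * Re (LINT x|lborel. f x * cnj (P x)) + (LINT x|lborel. (cmod (P x))\<^sup>2)"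
    by (rule integral_cmod_diff_squared[OF i1(1,3,2)])
  also have "(LINT x|lborel. (cmod (P x))\<^sup>2) = (\<Sum>n\<in>S. (cmod (a n))\<^sup>2)"
  proof -
    have "complex_of_real (LINT x|lborel. (cmod (P x))\<^sup>2) = of_real (\<Sum>n\<in>S. (cmod (a n))\<^sup>2)"
      by (simp only: integral_cmod_squared[OF bP] PP of_real_sum complex_norm_square)
    then show ?thesis by (simp only: of_real_eq_iff)
  qed
  also have "(LINT x|lborel. (cmod (f x))\<^sup>2) - 2 * Re (LINT x|lborel. f x * cnj (P x)) + (\<Sum>n\<in>S. (cmod (a n))\<^sup>2)
      = (LINT x|lborel. (cmod (f x))\<^sup>2) - (\<Sum>n\<in>S. (cmod (c n))\<^sup>2) + (\<Sum>n\<in>S. (cmod (a n - c n))\<^sup>2)"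
    unfolding fP cmod_diff_squared
    by (simp add: sum.distrib sum_subtractf sum_distrib_left algebra_simps)
  finally show ?thesis unfolding c_def .
qed

lemma parseval_unit_interval:
  fixes f :: "real \<Rightarrow> complex"
  assumes f: "bounded_supported f" and supp: "\<And>x. x \<notin> {0..1} \<Longrightarrow> f x = 0"
  shows "(\<integral>\<^sup>+n. ennreal ((cmod (ft f (of_int n)))\<^sup>2) \<partial>count_space UNIV) = energy lborel f"
proof -
  define K where "K = (LINT x|lborel. (cmod (f x))\<^sup>2)"
  have K: "energy lborel f = ennreal K"
    unfolding K_def by (intro energy_eq_integral bounded_supported_integrable_square f)
  have K0: "K \<ge> 0" unfolding K_def by (intro integral_nonneg_AE) auto
  note best = best_approximation[OF f supp, folded K_def]
  show ?thesis
  proof (rule antisym)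
    show "(\<integral>\<^sup>+n. ennreal ((cmod (ft f (of_int n)))\<^sup>2) \<partial>count_space UNIV) \<le> energy lborel f"
    proof (rule nn_integral_int_bound)
      fix S :: "int set" assume S: "finite S"
      have "0 \<le> (LINT x|lborel. indicator {0..1} x * (cmod (f x - (\<Sum>n\<in>S. ft f (of_int n) * phase (of_int n * x))))\<^sup>2)"
        by (intro integral_nonneg_AE) auto
      also have "\<dots> = K - (\<Sum>n\<in>S. (cmod (ft f (of_int n)))\<^sup>2)"
        by (subst best[OF _ S]) simp_all
      finally show "(\<Sum>n\<in>S. ennreal ((cmod (ft f (of_int n)))\<^sup>2)) \<le> energy lborel f"
        unfolding K by (subst sum_ennreal) (auto intro!: ennreal_leI)
    qed
    show "energy lborel f \<le> (\<integral>\<^sup>+n. ennreal ((cmod (ft f (of_int n)))\<^sup>2) \<partial>count_space UNIV)"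
    proof (rule ennreal_le_epsilon)
      fix \<epsilon> :: real assume \<epsilon>: "0 < \<epsilon>"
      obtain B where B: "\<forall>x. cmod (f x) \<le> B"
        using f unfolding bounded_supported_def by blast
      obtain q where q: "trig_poly q" "(LINT x|lborel. indicator {0..1} x * (cmod (f x - q x))\<^sup>2) < \<epsilon>"
        using trig_poly_L2_approx[OF bounded_supported_borel[OF f] spec[OF B] \<epsilon>] by (elim exE conjE)
      obtain S a where S: "finite S" and q_eq: "q = (\<lambda>x. \<Sum>n\<in>S. a n * phase (of_int n * x))"
        using q(1) unfolding trig_poly_def by (elim exE conjE)
      have "K - (\<Sum>n\<in>S. (cmod (ft f (of_int n)))\<^sup>2)
          \<le> (LINT x|lborel. indicator {0..1} x * (cmod (f x - q x))\<^sup>2)"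
        unfolding q_eq by (subst best[OF _ S]) (simp_all add: sum_nonneg)
      then have "K \<le> (\<Sum>n\<in>S. (cmod (ft f (of_int n)))\<^sup>2) + \<epsilon>" using q(2) by linarith
      then have "energy lborel f \<le> ennreal (\<Sum>n\<in>S. (cmod (ft f (of_int n)))\<^sup>2) + ennreal \<epsilon>"
        unfolding K using \<epsilon> by (subst ennreal_plus[symmetric]) (auto intro!: ennreal_leI sum_nonneg)
      also have "ennreal (\<Sum>n\<in>S. (cmod (ft f (of_int n)))\<^sup>2) = (\<Sum>n\<in>S. ennreal ((cmod (ft f (of_int n)))\<^sup>2))"
        by (subst sum_ennreal) auto
      also have "\<dots> \<le> (\<integral>\<^sup>+n. ennreal ((cmod (ft f (of_int n)))\<^sup>2) \<partial>count_space UNIV)"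
        by (rule sum_le_nn_integral_int[OF S])
      finally show "energy lborel f \<le> (\<integral>\<^sup>+n. ennreal ((cmod (ft f (of_int n)))\<^sup>2) \<partial>count_space UNIV) + ennreal \<epsilon>"
        by (simp add: add_right_mono)
    qed
  qed
qed

text \<open>Parseval's identity on an interval of length \<open>1 / L\<close>, whose dual lattice is \<open>L \<int>\<close>; it follows
  from the case of the unit interval by an affine substitution.\<close>

lemma parseval_interval:
  fixes f :: "real \<Rightarrow> complex" and L :: real
  assumes f: "bounded_supported f" and supp: "\<And>x. x \<notin> {a..a + 1 / L} \<Longrightarrow> f x = 0" and L: "L > 0"
  shows "ennreal L * (\<integral>\<^sup>+n. ennreal ((cmod (ft f (L * of_int n)))\<^sup>2) \<partial>count_space UNIV) = energy lborel f"
proof -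
  define g where "g x = f (a + (1 / L) * x)" for x
  have bg: "bounded_supported g"
    unfolding g_def using L by (intro bounded_supported_affine f) auto
  have g0: "g x = 0" if "x \<notin> {0..1}" for x
    unfolding g_def using L that by (intro supp) (auto simp: field_simps)
  have fg: "cmod (ft g (of_int n)) = L * cmod (ft f (L * of_int n))" for n
  proof -
    have "ft f (L * of_int n) = (1 / L) *\<^sub>R (LINT x|lborel. f (a + (1 / L) * x) * phase (- (L * of_int n * (a + (1 / L) * x))))"
      unfolding ft_def using L by (subst lborel_integral_real_affine[of "1 / L" _ a]) simp_all
    also have "(LINT x|lborel. f (a + (1 / L) * x) * phase (- (L * of_int n * (a + (1 / L) * x))))
        = (LINT x|lborel. phase (- (L * of_int n * a)) * (g x * phase (- (of_int n * x))))"
    proof (intro Bochner_Integration.integral_cong refl)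
      fix x
      have "- (L * of_int n * (a + (1 / L) * x)) = - (L * of_int n * a) + - (of_int n * x)"
        using L by (simp add: field_simps)
      then have "phase (- (L * of_int n * (a + (1 / L) * x))) = phase (- (L * of_int n * a)) * phase (- (of_int n * x))"
        by (simp only: phase_add)
      then show "f (a + (1 / L) * x) * phase (- (L * of_int n * (a + (1 / L) * x)))
          = phase (- (L * of_int n * a)) * (g x * phase (- (of_int n * x)))"
        by (simp only: g_def mult_ac)
    qed
    also have "\<dots> = phase (- (L * of_int n * a)) * ft g (of_int n)"
      by (simp add: ft_def)
    finally show ?thesis using L by (simp add: norm_mult)
  qed
  have [measurable]: "f \<in> borel_measurable borel" by (rule bounded_supported_borel[OF f])
  have "energy lborel f = ennreal (1 / L) * energy lborel g"
    unfolding energy_def g_def using L by (subst nn_integral_real_affine[of _ "1 / L" a]) simp_all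
  also have "energy lborel g = (\<integral>\<^sup>+n. ennreal ((cmod (ft g (of_int n)))\<^sup>2) \<partial>count_space UNIV)"
    by (rule parseval_unit_interval[OF bg g0, symmetric])
  also have "\<dots> = (\<integral>\<^sup>+n. ennreal (L\<^sup>2) * ennreal ((cmod (ft f (L * of_int n)))\<^sup>2) \<partial>count_space UNIV)"
    using L by (simp add: fg power_mult_distrib ennreal_mult)
  also have "\<dots> = ennreal (L\<^sup>2) * (\<integral>\<^sup>+n. ennreal ((cmod (ft f (L * of_int n)))\<^sup>2) \<partial>count_space UNIV)"
    by (rule nn_integral_cmult) simp
  finally have "energy lborel f = ennreal (1 / L) * ennreal (L\<^sup>2) * (\<integral>\<^sup>+n. ennreal ((cmod (ft f (L * of_int n)))\<^sup>2) \<partial>count_space UNIV)"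
    by (simp only: mult.assoc)
  also have "ennreal (1 / L) * ennreal (L\<^sup>2) = ennreal L"
    using L by (simp add: ennreal_mult[symmetric] power2_eq_square)
  finally show ?thesis by simp
qed

section \<open>Folding integrals over integer translates\<close>

text \<open>The translates of \<open>B\<close> by integers are disjoint, so the integral over their union is the sum of the
  integrals over the translates.\<close>

lemma nn_integral_fold_translates:
  fixes h :: "real \<Rightarrow> ennreal"
  assumes B: "B \<in> sets borel" and disj: "\<And>x n. x \<in> B \<Longrightarrow> x + of_int n \<in> B \<Longrightarrow> n = 0"
    and h: "h \<in> borel_measurable borel"
  shows "(\<integral>\<^sup>+x. h x * indicator {x. \<exists>n::int. x - of_int n \<in> B} x \<partial>lborel) =
         (\<integral>\<^sup>+x. indicator B x * (\<integral>\<^sup>+n. h (x + of_int n) \<partial>count_space (UNIV :: int set)) \<partial>lborel)"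
proof -
  note B[measurable] h[measurable]
  have "h x * indicator {x. \<exists>n::int. x - of_int n \<in> B} x = (\<integral>\<^sup>+n. h x * indicator B (x - of_int n) \<partial>count_space (UNIV :: int set))" for x
  proof (cases "\<exists>n::int. x - of_int n \<in> B")
    case True
    then obtain k :: int where k: "x - of_int k \<in> B" by blast
    have "n = k" if "x - of_int n \<in> B" for n :: int
    proof -
      have "x - of_int k + of_int (k - n) = x - of_int n" by simp
      then have "k - n = 0" using disj[OF k, of "k - n"] that by metis
      then show ?thesis by simp
    qed
    then have "x - of_int n \<in> B \<longleftrightarrow> n = k" for n :: int
      using k by blast
    then have "indicator B (x - of_int n) = (indicator {k} n :: ennreal)" for n
      by (simp add: indicator_def)
    then have "(\<integral>\<^sup>+n. h x * indicator B (x - of_int n) \<partial>count_space (UNIV :: int set)) = (\<integral>\<^sup>+n. h x * indicator {k} n \<partial>count_space UNIV)"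
      by simp
    also have "\<dots> = h x" by (subst nn_integral_indicator_singleton) auto
    finally show ?thesis using True by simp
  qed (simp add: indicator_def)
  then have "(\<integral>\<^sup>+x. h x * indicator {x. \<exists>n::int. x - of_int n \<in> B} x \<partial>lborel) =
      (\<integral>\<^sup>+x. (\<integral>\<^sup>+n. h x * indicator B (x - of_int n) \<partial>count_space (UNIV :: int set)) \<partial>lborel)"
    by simp
  also have "\<dots> = (\<integral>\<^sup>+n. (\<integral>\<^sup>+x. h x * indicator B (x - of_int n) \<partial>lborel) \<partial>count_space (UNIV :: int set))"
    by (rule nn_integral_count_space_nn_integral) auto
  also have "\<dots> = (\<integral>\<^sup>+n. (\<integral>\<^sup>+x. indicator B x * h (x + of_int n) \<partial>lborel) \<partial>count_space (UNIV :: int set))"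
  proof (rule nn_integral_cong)
    fix n :: int
    show "(\<integral>\<^sup>+x. h x * indicator B (x - of_int n) \<partial>lborel) = (\<integral>\<^sup>+x. indicator B x * h (x + of_int n) \<partial>lborel)"
      by (subst nn_integral_real_affine[where c = 1 and t = "of_int n"]) (simp_all add: ac_simps)
  qed
  also have "\<dots> = (\<integral>\<^sup>+x. (\<integral>\<^sup>+n. indicator B x * h (x + of_int n) \<partial>count_space (UNIV :: int set)) \<partial>lborel)"
    by (rule nn_integral_count_space_nn_integral[symmetric]) auto
  also have "\<dots> = (\<integral>\<^sup>+x. indicator B x * (\<integral>\<^sup>+n. h (x + of_int n) \<partial>count_space (UNIV :: int set)) \<partial>lborel)"
    by (simp add: nn_integral_cmult)
  finally show ?thesis .
qed

lemma nn_integral_fold_unit: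
  fixes h :: "real \<Rightarrow> ennreal"
  assumes "h \<in> borel_measurable borel"
  shows "(\<integral>\<^sup>+x. h x \<partial>lborel) =
         (\<integral>\<^sup>+x. indicator {0..<1} x * (\<integral>\<^sup>+n. h (x + of_int n) \<partial>count_space (UNIV :: int set)) \<partial>lborel)"
proof -
  have "\<exists>n::int. x - of_int n \<in> {0..<1}" for x :: real
    by (intro exI[of _ "\<lfloor>x\<rfloor>"]) (auto; linarith)
  then have "(\<integral>\<^sup>+x. h x \<partial>lborel) = (\<integral>\<^sup>+x. h x * indicator {x. \<exists>n::int. x - of_int n \<in> {0..<1}} x \<partial>lborel)"
    by simp
  also have "\<dots> = (\<integral>\<^sup>+x. indicator {0..<1} x * (\<integral>\<^sup>+n. h (x + of_int n) \<partial>count_space (UNIV :: int set)) \<partial>lborel)"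
    by (rule nn_integral_fold_translates[OF _ _ assms]) auto
  finally show ?thesis .
qed

section \<open>The periodic interval measure\<close>

definition cell :: "nat \<Rightarrow> real set" where
  "cell p = {- 1 / (2 * real p) .. 1 / (2 * real p)}"

definition cells :: "nat \<Rightarrow> real set" where
  "cells p = {t. \<exists>n::int. t - of_int n \<in> cell p}"

lemma cell_borel [measurable]: "cell p \<in> sets borel"
  unfolding cell_def by simp

lemma cells_borel [measurable]: "cells p \<in> sets borel"
  unfolding cells_def by measurable

lemma cell_disjoint:
  assumes "p \<ge> 2" "t \<in> cell p" "t + of_int n \<in> cell p"
  shows "n = 0"
proof -
  have "1 / (2 * real p) \<le> 1 / 4" using assms(1) by (simp add: field_simps)
  then have "\<bar>real_of_int n\<bar> < 1" using assms(2,3) unfolding cell_def by auto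
  then show ?thesis by linarith
qed

lemma periodic_interval_measure_eq:
  "periodic_interval_measure p = density lborel (\<lambda>t. ennreal (real p) * indicator (cells p) t)"
proof -
  have A: "{- 1 / (2 * real p) .. 1 / (2 * real p)} + \<int> = cells p"
  proof (intro set_eqI iffI)
    fix t assume "t \<in> {- 1 / (2 * real p) .. 1 / (2 * real p)} + \<int>"
    then obtain s z where sz: "t = s + z" "s \<in> cell p" "z \<in> \<int>"
      unfolding cell_def by (rule set_plus_elim)
    obtain n :: int where "z = of_int n" using sz(3) by (rule Ints_cases)
    with sz show "t \<in> cells p" unfolding cells_def by (intro CollectI exI[of _ n]) simp
  next
    fix t assume "t \<in> cells p"
    then obtain n :: int where "t - of_int n \<in> cell p" unfolding cells_def by blast
    then have "(t - of_int n) + of_int n \<in> {- 1 / (2 * real p) .. 1 / (2 * real p)} + \<int>"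
      unfolding cell_def by (intro set_plus_intro Ints_of_int)
    then show "t \<in> {- 1 / (2 * real p) .. 1 / (2 * real p)} + \<int>" by simp
  qed
  show ?thesis
  proof (rule measure_eqI)
    fix X assume "X \<in> sets (periodic_interval_measure p)"
    then have [measurable]: "X \<in> sets borel" by (simp add: periodic_interval_measure_def)
    show "emeasure (periodic_interval_measure p) X = emeasure (density lborel (\<lambda>t. ennreal (real p) * indicator (cells p) t)) X"
      unfolding periodic_interval_measure_def A
      by (simp add: emeasure_density nn_integral_cmult mult.assoc ennreal_of_nat_eq_real_of_nat)
  qed (simp add: periodic_interval_measure_def)
qed

lemma sets_periodic_interval_measure [measurable_cong, simp]: "sets (periodic_interval_measure p) = sets borel"
  by (simp add: periodic_interval_measure_def)

lemma space_periodic_interval_measure [simp]: "space (periodic_interval_measure p) = UNIV"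
  by (simp add: periodic_interval_measure_eq)

lemma nn_integral_periodic_interval_measure:
  assumes p: "p \<ge> 2" and h: "h \<in> borel_measurable borel"
  shows "(\<integral>\<^sup>+t. h t \<partial>periodic_interval_measure p) =
    ennreal (real p) * (\<integral>\<^sup>+t. indicator (cell p) t * (\<integral>\<^sup>+n. h (t + of_int n) \<partial>count_space (UNIV :: int set)) \<partial>lborel)"
proof -
  note h[measurable]
  have "(\<integral>\<^sup>+t. h t \<partial>periodic_interval_measure p) = ennreal (real p) * (\<integral>\<^sup>+t. h t * indicator (cells p) t \<partial>lborel)"
    unfolding periodic_interval_measure_eq
    by (subst nn_integral_density) (simp_all add: nn_integral_cmult mult.assoc mult.commute[of "h _"])
  also have "(\<integral>\<^sup>+t. h t * indicator (cells p) t \<partial>lborel)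
      = (\<integral>\<^sup>+t. indicator (cell p) t * (\<integral>\<^sup>+n. h (t + of_int n) \<partial>count_space (UNIV :: int set)) \<partial>lborel)"
    unfolding cells_def by (rule nn_integral_fold_translates) (use cell_disjoint[OF p] h in auto)
  finally show ?thesis .
qed

text \<open>Inner regularity holds for each of the finite measures obtained by restriction to \<open>[-N, N]\<close>,
  and is inherited by their increasing limit.\<close>

lemma radon_periodic_interval_measure: "radon_measure (periodic_interval_measure p)"
  unfolding radon_measure_def
proof (intro conjI allI impI ballI)
  let ?\<mu> = "periodic_interval_measure p"
  show "sets ?\<mu> = sets borel" by simp
  have le: "emeasure ?\<mu> X \<le> ennreal (real p) * emeasure lborel X" if [measurable]: "X \<in> sets borel" for X
  proof -
    have "emeasure ?\<mu> X = (\<integral>\<^sup>+t. ennreal (real p) * indicator (cells p) t * indicator X t \<partial>lborel)"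
      unfolding periodic_interval_measure_eq by (subst emeasure_density) auto
    also have "\<dots> \<le> (\<integral>\<^sup>+t. ennreal (real p) * indicator X t \<partial>lborel)"
      by (intro nn_integral_mono) (auto simp: indicator_def)
    also have "\<dots> = ennreal (real p) * emeasure lborel X" by (simp add: nn_integral_cmult)
    finally show ?thesis .
  qed
  have fin: "emeasure ?\<mu> K < \<infinity>" if "compact K" for K
    using le[of K] emeasure_compact_finite[OF that] borel_compact[OF that]
    by (auto simp: ennreal_mult_less_top intro: le_less_trans)
  then show "emeasure ?\<mu> K < \<infinity>" if "compact K" for K using that .
  fix B :: "real set" assume B[measurable]: "B \<in> sets borel"
  let ?S = "SUP K\<in>{K. K \<subseteq> B \<and> compact K}. emeasure ?\<mu> K"
  show "emeasure ?\<mu> B = ?S"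
  proof (rule antisym)
    show "?S \<le> emeasure ?\<mu> B" by (rule SUP_least) (auto intro: emeasure_mono)
    have "emeasure ?\<mu> (\<Union>N. {- real N..real N} \<inter> B) = (SUP N. emeasure ?\<mu> ({- real N..real N} \<inter> B))"
      by (rule SUP_emeasure_incseq[symmetric]) (auto simp: incseq_def)
    also have "(\<Union>N. {- real N..real N} \<inter> B) = B"
    proof -
      have "\<exists>N. x \<in> {- real N..real N}" for x :: real
        using real_arch_simple[of "\<bar>x\<bar>"] by (auto simp: abs_le_iff) (metis minus_le_iff)
      then show ?thesis by blast
    qed
    also have "(SUP N. emeasure ?\<mu> ({- real N..real N} \<inter> B)) \<le> ?S"
    proof (rule SUP_least)
      fix N :: nat
      define \<nu> where "\<nu> = density ?\<mu> (indicator {- real N..real N})"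
      have \<nu>: "emeasure \<nu> X = emeasure ?\<mu> ({- real N..real N} \<inter> X)" if "X \<in> sets borel" for X
        unfolding \<nu>_def using that by (subst emeasure_restricted) auto
      have "emeasure \<nu> B = (SUP K\<in>{K. K \<subseteq> B \<and> compact K}. emeasure \<nu> K)"
      proof (rule inner_regular)
        show "emeasure \<nu> (space \<nu>) \<noteq> \<infinity>"
          using fin[of "{- real N..real N}"] \<nu>[of UNIV] by (simp add: \<nu>_def)
      qed (auto simp: \<nu>_def)
      also have "\<dots> \<le> ?S"
      proof (rule SUP_least)
        fix K assume K: "K \<in> {K. K \<subseteq> B \<and> compact K}"
        have "emeasure \<nu> K = emeasure ?\<mu> ({- real N..real N} \<inter> K)"
          using K by (intro \<nu> borel_compact) simp
        also have "\<dots> \<le> emeasure ?\<mu> K"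
          using K by (intro emeasure_mono) (auto simp: borel_compact)
        also have "\<dots> \<le> ?S" using K by (intro SUP_upper)
        finally show "emeasure \<nu> K \<le> ?S" .
      qed
      finally show "emeasure ?\<mu> ({- real N..real N} \<inter> B) \<le> ?S" by (simp add: \<nu>)
    qed
    finally show "emeasure ?\<mu> B \<le> ?S" .
  qed
qed

section \<open>The energy of a transform as an integral over fibres\<close>

lemma ft_borel [measurable]:
  assumes [measurable]: "f \<in> borel_measurable borel"
  shows "ft f \<in> borel_measurable borel"
  unfolding ft_def by measurable

text \<open>The squared norm of the trigonometric polynomial with coefficients \<open>c\<close> in \<open>L\<^sup>2\<close> of the base cell with
  normalised measure.\<close>

definition fibre_energy :: "nat \<Rightarrow> int set \<Rightarrow> (int \<Rightarrow> complex) \<Rightarrow> ennreal" where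
  "fibre_energy p T c = ennreal (real p) *
     (\<integral>\<^sup>+t. indicator (cell p) t * ennreal ((cmod (\<Sum>m\<in>T. c m * phase (- (of_int m * t))))\<^sup>2) \<partial>lborel)"

text \<open>For fixed \<open>t\<close>, the values of the transform at \<open>t + n\<close> are the Fourier coefficients of the Zak
  transform \<open>x \<mapsto> (\<Sum>m. f (x + m) phase (- t (x + m)))\<close> on the unit interval. Parseval's identity there,
  followed by Tonelli's theorem, turns the energy over \<open>cells p\<close> into an integral over fibres of the
  mean over \<open>t\<close> in the base cell.\<close>

lemma energy_fibre_formula:
  fixes M :: int
  assumes p: "p \<ge> 2" and f: "bounded_supported f"
    and supp: "\<And>x. x \<notin> {- of_int M..<of_int M} \<Longrightarrow> f x = 0"
  shows "energy (periodic_interval_measure p) (ft f) =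
    (\<integral>\<^sup>+x. indicator {0..<1} x * fibre_energy p {- M..<M} (\<lambda>m. f (x + of_int m)) \<partial>lborel)"
proof -
  define T where "T = {- M..<M}"
  \<comment> \<open>The Zak transform of \<open>f\<close> at \<open>t\<close>, restricted to the unit interval.\<close>
  define G where "G t x = (\<Sum>m\<in>T. f (x + of_int m) * phase (- (t * (x + of_int m)))) * indicator {0..<1} x" for t x
  note [measurable] = bounded_supported_borel[OF f]
  have bf: "bounded_supported (\<lambda>x. f x * phase (- (t * x)))" for t
    using bounded_supported_phase[OF f, of "-t"] by simp
  have bfm: "bounded_supported (\<lambda>x. f (x + of_int m) * phase (- (t * (x + of_int m))))" for t m
    using bounded_supported_affine[OF bf[of t], of 1 "of_int m"] by (simp add: add.commute)
  have bG: "bounded_supported (G t)" for t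
    unfolding G_def by (intro bounded_supported_indicator bounded_supported_sum bfm) (auto simp: T_def)
  have G0: "G t x = 0" if "x \<notin> {0..1}" for t x
    using that by (auto simp: G_def indicator_def)
  have ftG: "ft (G t) (of_int n) = ft f (t + of_int n)" for t n
  proof -
    let ?g = "\<lambda>x. f x * phase (- ((t + of_int n) * x))"
    have bg: "bounded_supported ?g" by (rule bf)
    have eq: "G t x * phase (- (of_int n * x)) = (\<Sum>m\<in>T. ?g (x + of_int m) * indicator {0..<1} x)" for x
    proof -
      have "phase (- (t * (x + of_int m))) * phase (- (of_int n * x)) = phase (- ((t + of_int n) * (x + of_int m)))" for m
      proof -
        have "- (t * (x + of_int m)) + - (of_int n * x) = - ((t + of_int n) * (x + of_int m)) + of_int (n * m)"
          by (simp add: algebra_simps)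
        then have "phase (- (t * (x + of_int m))) * phase (- (of_int n * x)) = phase (- ((t + of_int n) * (x + of_int m)) + of_int (n * m))"
          by (simp only: phase_add[symmetric])
        then show ?thesis by (simp only: phase_add phase_of_int mult_1_right)
      qed
      then show ?thesis
        unfolding G_def sum_distrib_right
        by (intro sum.cong refl) (simp only: mult_ac)
    qed
    have "ft (G t) (of_int n) = (\<Sum>m\<in>T. LINT x|lborel. ?g (x + of_int m) * indicator {0..<1} x)"
    proof -
      have "bounded_supported (\<lambda>x. ?g (x + of_int m) * indicator {0..<1} x)" for m
        using bounded_supported_indicator[OF bounded_supported_affine[OF bg, of 1 "of_int m"], of "{0..<1}"] by (simp add: add.commute)
      then show ?thesis
        unfolding ft_def eq by (intro Bochner_Integration.integral_sum bounded_supported_integrable)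
    qed
    also have "\<dots> = (\<Sum>m\<in>T. LINT x|lborel. ?g x * indicator {0..<1} (x - of_int m))"
    proof (rule sum.cong)
      fix m
      show "(LINT x|lborel. ?g (x + of_int m) * indicator {0..<1} x) = (LINT x|lborel. ?g x * indicator {0..<1} (x - of_int m))"
        by (subst (2) lborel_integral_real_affine[of 1 _ "of_int m"]) (simp_all add: add.commute)
    qed simp
    also have "\<dots> = (LINT x|lborel. (\<Sum>m\<in>T. ?g x * indicator {0..<1} (x - of_int m)))"
    proof (rule Bochner_Integration.integral_sum[symmetric])
      fix m
      have "indicator {0..<1} (x - of_int m) = (indicator {of_int m..<1 + of_int m} x :: complex)" for x :: real
        by (auto simp: indicator_def)
      then show "integrable lborel (\<lambda>x. ?g x * indicator {0..<1} (x - of_int m))"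
        by (simp only:) (intro bounded_supported_integrable bounded_supported_indicator bg; simp)
    qed
    also have "\<dots> = (LINT x|lborel. ?g x)"
    proof (intro Bochner_Integration.integral_cong refl)
      fix x
      show "(\<Sum>m\<in>T. ?g x * indicator {0..<1} (x - of_int m)) = ?g x"
      proof (cases "x \<in> {- of_int M..<of_int M}")
        case True
        then have "\<lfloor>x\<rfloor> \<in> T" unfolding T_def by (simp add: le_floor_iff floor_less_iff)
        have ind: "indicator {0..<1} (x - of_int m) = (if m = \<lfloor>x\<rfloor> then 1 else 0 :: complex)" for m
          by (auto simp: indicator_def) linarith+
        have "(\<Sum>m\<in>T. ?g x * indicator {0..<1} (x - of_int m)) = (\<Sum>m\<in>T. if m = \<lfloor>x\<rfloor> then ?g x else 0)"
          unfolding ind by (intro sum.cong) auto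
        also have "\<dots> = ?g x"
          using \<open>\<lfloor>x\<rfloor> \<in> T\<close> by (subst sum.delta) (auto simp: T_def)
        finally show ?thesis .
      qed (simp add: supp)
    qed
    finally show ?thesis by (simp add: ft_def)
  qed
  have energyG: "energy lborel (G t) = (\<integral>\<^sup>+x. indicator {0..<1} x *
      ennreal ((cmod (\<Sum>m\<in>T. f (x + of_int m) * phase (- (of_int m * t))))\<^sup>2) \<partial>lborel)" for t
    unfolding energy_def
  proof (intro nn_integral_cong)
    fix x
    have "(\<Sum>m\<in>T. f (x + of_int m) * phase (- (t * (x + of_int m))))
        = phase (- (t * x)) * (\<Sum>m\<in>T. f (x + of_int m) * phase (- (of_int m * t)))"
      unfolding sum_distrib_left
    proof (intro sum.cong refl)
      fix m
      have "- (t * (x + of_int m)) = - (t * x) + - (of_int m * t)" by (simp add: algebra_simps)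
      then have "phase (- (t * (x + of_int m))) = phase (- (t * x)) * phase (- (of_int m * t))"
        by (simp only: phase_add)
      then show "f (x + of_int m) * phase (- (t * (x + of_int m))) = phase (- (t * x)) * (f (x + of_int m) * phase (- (of_int m * t)))"
        by (simp only: mult_ac)
    qed
    then show "ennreal ((cmod (G t x))\<^sup>2) = indicator {0..<1} x *
        ennreal ((cmod (\<Sum>m\<in>T. f (x + of_int m) * phase (- (of_int m * t))))\<^sup>2)"
      by (simp add: G_def norm_mult indicator_def)
  qed
  have "energy (periodic_interval_measure p) (ft f) = ennreal (real p) *
     (\<integral>\<^sup>+t. indicator (cell p) t * (\<integral>\<^sup>+n. ennreal ((cmod (ft f (t + of_int n)))\<^sup>2) \<partial>count_space (UNIV :: int set)) \<partial>lborel)"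
    unfolding energy_def by (rule nn_integral_periodic_interval_measure[OF p]) measurable
  also have "(\<lambda>t. \<integral>\<^sup>+n. ennreal ((cmod (ft f (t + of_int n)))\<^sup>2) \<partial>count_space (UNIV :: int set)) = (\<lambda>t. energy lborel (G t))"
    unfolding ftG[symmetric] by (intro ext parseval_unit_interval bG G0)
  also have "(\<integral>\<^sup>+t. indicator (cell p) t * energy lborel (G t) \<partial>lborel) =
     (\<integral>\<^sup>+t. \<integral>\<^sup>+x. indicator (cell p) t * (indicator {0..<1} x *
      ennreal ((cmod (\<Sum>m\<in>T. f (x + of_int m) * phase (- (of_int m * t))))\<^sup>2)) \<partial>lborel \<partial>lborel)"
    unfolding energyG by (simp add: nn_integral_cmult)
  also have "\<dots> = (\<integral>\<^sup>+x. \<integral>\<^sup>+t. indicator (cell p) t * (indicator {0..<1} x *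
      ennreal ((cmod (\<Sum>m\<in>T. f (x + of_int m) * phase (- (of_int m * t))))\<^sup>2)) \<partial>lborel \<partial>lborel)"
    by (rule lborel_pair.Fubini') (simp add: T_def)
  also have "ennreal (real p) * \<dots> = (\<integral>\<^sup>+x. ennreal (real p) * (\<integral>\<^sup>+t. indicator (cell p) t * (indicator {0..<1} x *
      ennreal ((cmod (\<Sum>m\<in>T. f (x + of_int m) * phase (- (of_int m * t))))\<^sup>2)) \<partial>lborel) \<partial>lborel)"
    by (rule nn_integral_cmult[symmetric]) simp
  also have "\<dots> = (\<integral>\<^sup>+x. indicator {0..<1} x * fibre_energy p T (\<lambda>m. f (x + of_int m)) \<partial>lborel)"
    unfolding fibre_energy_def by (intro nn_integral_cong) (simp add: indicator_def)
  finally show ?thesis unfolding T_def .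
qed

section \<open>Fourier coefficients of the base cell\<close>

text \<open>The Fourier coefficients of the normalised indicator of the base cell, a sampled sinc function.
  It vanishes exactly at the nonzero multiples of \<open>p\<close>, which is the arithmetic behind the theorem.\<close>

definition cell_kernel :: "nat \<Rightarrow> int \<Rightarrow> real" where
  "cell_kernel p d = (if d = 0 then 1 else sin (pi * of_int d / real p) / (pi * of_int d / real p))"

lemma integral_phase_cell:
  assumes p: "p \<ge> 2"
  shows "of_nat p * (LINT t|lborel. indicator (cell p) t * phase (of_int d * t)) = of_real (cell_kernel p d)"
proof (cases "d = 0")
  case True
  have "(LINT t|lborel. of_real (indicator (cell p) t)) = complex_of_real (LINT t|lborel. indicator (cell p) t)"
    by (rule integral_complex_of_real)
  also have "(LINT t|lborel. indicator (cell p) t) = (1 / real p :: real)"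
    using p by (simp add: cell_def field_simps)
  finally have "(LINT t|lborel. (indicator (cell p) t :: complex)) = of_real (1 / real p)"
    by (simp add: indicator_def of_bool_def if_distrib cong: if_cong)
  then show ?thesis using True p by (simp add: cell_kernel_def)
next
  case False
  define y where "y = pi * of_int d / real p"
  have "(LINT t|lborel. indicator (cell p) t * phase (of_int d * t)) =
      (phase (of_int d * (1 / (2 * real p))) - phase (of_int d * (- 1 / (2 * real p)))) / (2 * of_real pi * \<i> * of_real (of_int d))"
    unfolding cell_def using False p by (intro integral_phase_Icc) auto
  also have "phase (of_int d * (1 / (2 * real p))) - phase (of_int d * (- 1 / (2 * real p))) = 2 * \<i> * of_real (sin y)"
  proof -
    have "2 * pi * (of_int d * (1 / (2 * real p))) = y" "2 * pi * (of_int d * (- 1 / (2 * real p))) = - y"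
      unfolding y_def by (simp_all add: field_simps)
    then show ?thesis unfolding phase_def by (simp add: complex_eq_iff)
  qed
  also have "2 * \<i> * of_real (sin y) / (2 * of_real pi * \<i> * of_real (of_int d)) = of_real (sin y / (pi * of_int d))"
    by simp
  also have "of_nat p * of_real (sin y / (pi * of_int d)) = complex_of_real (sin y / y)"
    using p False by (simp add: y_def field_simps)
  finally show ?thesis using False by (simp add: cell_kernel_def y_def)
qed

lemma cell_kernel_eq_0_iff:
  assumes p: "p \<ge> 2" and d: "d \<noteq> 0"
  shows "cell_kernel p d = 0 \<longleftrightarrow> int p dvd d"
proof -
  have "cell_kernel p d = 0 \<longleftrightarrow> sin (pi * of_int d / real p) = 0"
    using p d by (simp add: cell_kernel_def)
  also have "\<dots> \<longleftrightarrow> (\<exists>k::int. pi * of_int d / real p = of_int k * pi)"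
    by (rule sin_zero_iff_int2)
  also have "\<dots> \<longleftrightarrow> (\<exists>k::int. d = int p * k)"
  proof (intro ex_cong1)
    fix k :: int
    have "pi * of_int d / real p = of_int k * pi \<longleftrightarrow> real_of_int d = of_int (int p * k)"
      using p by (auto simp: field_simps)
    then show "pi * of_int d / real p = of_int k * pi \<longleftrightarrow> d = int p * k" by (simp only: of_int_eq_iff)
  qed
  finally show ?thesis by (simp add: dvd_def)
qed

lemma bounded_supported_cell: "bounded_supported (indicator (cell p))"
  unfolding cell_def by (rule bounded_supported_indicator_Icc)

lemma fibre_energy_eq:
  assumes p: "p \<ge> 2" and T: "finite T"
  shows "fibre_energy p T c = ennreal (Re (\<Sum>m\<in>T. \<Sum>k\<in>T. c m * cnj (c k) * of_real (cell_kernel p (k - m))))"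
proof -
  define h where "h t = indicator (cell p) t * (\<Sum>m\<in>T. c m * phase (- (of_int m * t)))" for t
  have b1: "bounded_supported (\<lambda>t. indicator (cell p) t * phase (- (of_int m * t)))" for m :: int
    using bounded_supported_phase[OF bounded_supported_cell, of p "- of_int m"] by simp
  have h_eq: "h = (\<lambda>t. \<Sum>m\<in>T. c m * (indicator (cell p) t * phase (- (of_int m * t))))"
    by (simp add: h_def fun_eq_iff sum_distrib_left mult_ac)
  have bh: "bounded_supported h"
    unfolding h_eq by (intro bounded_supported_sum bounded_supported_cmult b1 T)
  have "(\<integral>\<^sup>+t. indicator (cell p) t * ennreal ((cmod (\<Sum>m\<in>T. c m * phase (- (of_int m * t))))\<^sup>2) \<partial>lborel) = energy lborel h"
    unfolding energy_def h_def by (intro nn_integral_cong) (simp add: indicator_def)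
  also have "\<dots> = ennreal (LINT t|lborel. (cmod (h t))\<^sup>2)"
    by (intro energy_eq_integral bounded_supported_integrable_square bh)
  finally have "fibre_energy p T c = ennreal (real p * (LINT t|lborel. (cmod (h t))\<^sup>2))"
    unfolding fibre_energy_def by (simp add: ennreal_mult)
  moreover have "complex_of_real (real p * (LINT t|lborel. (cmod (h t))\<^sup>2))
      = (\<Sum>m\<in>T. \<Sum>k\<in>T. c m * cnj (c k) * of_real (cell_kernel p (k - m)))"
  proof -
    have "h t * cnj (h t) = (\<Sum>m\<in>T. \<Sum>k\<in>T. c m * cnj (c k) * (indicator (cell p) t * phase (of_int (k - m) * t)))" for t
    proof -
      have "phase (- (of_int m * t)) * phase (of_int k * t) = phase (of_int (k - m) * t)" for m k :: int
        by (simp add: algebra_simps flip: phase_add)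
      then have *: "(c m * (indicator (cell p) t * phase (- (of_int m * t)))) * cnj (c k * (indicator (cell p) t * phase (- (of_int k * t))))
          = c m * cnj (c k) * (indicator (cell p) t * phase (of_int (k - m) * t))" for m k :: int
        by (auto simp: indicator_def mult_ac)
      show ?thesis unfolding h_eq cnj_sum sum_product * ..
    qed
    moreover have "integrable lborel (\<lambda>t. c m * cnj (c k) * (indicator (cell p) t * phase (of_int (k - m) * t)))" for m k
      by (intro integrable_mult_right bounded_supported_integrable bounded_supported_phase bounded_supported_cell)
    ultimately have "(LINT t|lborel. h t * cnj (h t)) = (\<Sum>m\<in>T. \<Sum>k\<in>T. c m * cnj (c k) * (LINT t|lborel. indicator (cell p) t * phase (of_int (k - m) * t)))"
      by (simp add: Bochner_Integration.integral_sum Bochner_Integration.integrable_sum)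
    then have "of_nat p * (LINT t|lborel. h t * cnj (h t)) = (\<Sum>m\<in>T. \<Sum>k\<in>T. c m * cnj (c k) * (of_nat p * (LINT t|lborel. indicator (cell p) t * phase (of_int (k - m) * t))))"
      by (simp only: sum_distrib_left mult_ac)
    then show ?thesis
      unfolding integral_phase_cell[OF p] by (simp add: integral_cmod_squared[OF bh, symmetric])
  qed
  ultimately show ?thesis by (metis Re_complex_of_real)
qed

text \<open>The exponentials with frequencies in one residue class modulo \<open>p\<close> are orthonormal on the
  base cell.\<close>

lemma fibre_energy_residue_class:
  assumes p: "p \<ge> 2" and T: "finite T" and c: "\<And>m k. c m \<noteq> 0 \<Longrightarrow> c k \<noteq> 0 \<Longrightarrow> int p dvd k - m"
  shows "fibre_energy p T c = (\<Sum>m\<in>T. ennreal ((cmod (c m))\<^sup>2))"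
proof -
  have "c m * cnj (c k) * of_real (cell_kernel p (k - m)) = (if k = m then of_real ((cmod (c m))\<^sup>2) else 0)" for m k
    using c[of m k] cell_kernel_eq_0_iff[OF p, of "k - m"]
    by (auto simp: complex_norm_square cell_kernel_def simp del: of_real_power)
  then have "(\<Sum>m\<in>T. \<Sum>k\<in>T. c m * cnj (c k) * of_real (cell_kernel p (k - m))) = of_real (\<Sum>m\<in>T. (cmod (c m))\<^sup>2)"
    using T by simp
  then show ?thesis
    unfolding fibre_energy_eq[OF p T] by (simp only: Re_complex_of_real) (simp add: sum_ennreal)
qed

text \<open>The cross term \<open>2 * cell_kernel p d\<close> is what two points of a fibre at distance \<open>d\<close> add to the
  sum of their squares; isometry requires it to vanish.\<close>

lemma fibre_energy_two_points:
  assumes p: "p \<ge> 2" and T: "finite T" "m \<in> T" "m + d \<in> T" and d: "d \<noteq> 0"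
    and c: "\<And>k. c k = (if k = m \<or> k = m + d then 1 else 0)"
  shows "fibre_energy p T c = ennreal (2 + 2 * cell_kernel p d)"
proof -
  have sub: "(\<Sum>k\<in>T. f k * c k) = f m + f (m + d)" "(\<Sum>k\<in>T. c k * f k) = f m + f (m + d)" for f :: "int \<Rightarrow> complex"
  proof -
    have "(\<Sum>k\<in>T. f k * c k) = (\<Sum>k\<in>{m, m + d}. f k)"
      using T by (intro sum.mono_neutral_cong_right) (auto simp: c)
    then show "(\<Sum>k\<in>T. f k * c k) = f m + f (m + d)" using d by simp
    then show "(\<Sum>k\<in>T. c k * f k) = f m + f (m + d)" by (simp only: mult.commute[of "c _"])
  qed
  have ker: "cell_kernel p (- d) = cell_kernel p d" by (simp add: cell_kernel_def)
  have "cnj (c k) = c k" for k by (simp add: c)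
  then have "(\<Sum>i\<in>T. \<Sum>k\<in>T. c i * cnj (c k) * of_real (cell_kernel p (k - i)))
      = (\<Sum>i\<in>T. c i * (\<Sum>k\<in>T. c k * of_real (cell_kernel p (k - i))))"
    by (simp add: sum_distrib_left mult_ac)
  also have "\<dots> = of_real (2 + 2 * cell_kernel p d)"
    unfolding sub by (simp add: ker) (simp add: cell_kernel_def)
  finally show ?thesis unfolding fibre_energy_eq[OF p T(1)] by (simp only: Re_complex_of_real)
qed

section \<open>Isometry on sets whose fibres lie in residue classes\<close>

text \<open>Every fibre \<open>{n. x + n \<in> S}\<close> lies in a single residue class modulo \<open>p\<close>.\<close>

definition residue_separated :: "nat \<Rightarrow> real set \<Rightarrow> bool" where
  "residue_separated p S \<longleftrightarrow> (\<forall>x n. x \<in> S \<longrightarrow> x + of_int n \<in> S \<longrightarrow> int p dvd n)"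

lemma bounded_supported_vanishes_off_interval:
  assumes "bounded_supported f"
  shows "\<exists>M::int. \<forall>x. x \<notin> {- of_int M..<of_int M} \<longrightarrow> f x = 0"
proof -
  obtain R where R: "\<And>x. f x \<noteq> 0 \<Longrightarrow> \<bar>x\<bar> \<le> R"
    using assms unfolding bounded_supported_def by blast
  show ?thesis
  proof (intro exI[of _ "\<lfloor>R\<rfloor> + 1"] allI impI)
    fix x :: real assume "x \<notin> {- of_int (\<lfloor>R\<rfloor> + 1)..<of_int (\<lfloor>R\<rfloor> + 1)}"
    then have "\<not> \<bar>x\<bar> \<le> R" by (auto simp: abs_le_iff) linarith+
    then show "f x = 0" using R by blast
  qed
qed

text \<open>On each fibre the values of \<open>f\<close> occur in one residue class, so the fibre energy is the sum of
  their squares, and folding recovers the integral of \<open>\<bar>f\<bar>\<^sup>2\<close> over the line.\<close>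

lemma isometry_bounded_supported:
  assumes p: "p \<ge> 2" and f: "bounded_supported f"
    and S: "residue_separated p S" and supp: "\<And>x. x \<notin> S \<Longrightarrow> f x = 0"
  shows "energy (periodic_interval_measure p) (ft f) = energy lborel f"
proof -
  obtain M :: int where M: "\<And>x. x \<notin> {- of_int M..<of_int M} \<Longrightarrow> f x = 0"
    using bounded_supported_vanishes_off_interval[OF f] by blast
  note [measurable] = bounded_supported_borel[OF f]
  have "energy lborel f = (\<integral>\<^sup>+x. indicator {0..<1} x * (\<integral>\<^sup>+n. ennreal ((cmod (f (x + of_int n)))\<^sup>2) \<partial>count_space (UNIV :: int set)) \<partial>lborel)"
    unfolding energy_def by (rule nn_integral_fold_unit) measurable
  also have "\<dots> = (\<integral>\<^sup>+x. indicator {0..<1} x * fibre_energy p {- M..<M} (\<lambda>m. f (x + of_int m)) \<partial>lborel)"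
  proof (rule nn_integral_cong)
    fix x :: real
    show "indicator {0..<1} x * (\<integral>\<^sup>+n. ennreal ((cmod (f (x + of_int n)))\<^sup>2) \<partial>count_space (UNIV :: int set))
        = indicator {0..<1} x * fibre_energy p {- M..<M} (\<lambda>m. f (x + of_int m))"
    proof (cases "x \<in> {0..<1}")
      case True
      have "f (x + of_int n) = 0" if "n \<notin> {- M..<M}" for n
      proof (rule M)
        show "x + of_int n \<notin> {- of_int M..<of_int M}"
        proof (cases "n < - M")
          case True
          then have "real_of_int n \<le> - of_int M - 1" by linarith
          then show ?thesis using \<open>x \<in> {0..<1}\<close> by auto
        next
          case False
          then have "real_of_int n \<ge> of_int M" using that by auto
          then show ?thesis using \<open>x \<in> {0..<1}\<close> by auto
        qed
      qed
      then have "(\<integral>\<^sup>+n. ennreal ((cmod (f (x + of_int n)))\<^sup>2) \<partial>count_space (UNIV :: int set)) = (\<Sum>n\<in>{- M..<M}. ennreal ((cmod (f (x + of_int n)))\<^sup>2))"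
        by (intro nn_integral_count_space') auto
      also have "\<dots> = fibre_energy p {- M..<M} (\<lambda>m. f (x + of_int m))"
      proof (rule fibre_energy_residue_class[OF p, symmetric])
        fix m k :: int assume "f (x + of_int m) \<noteq> 0" "f (x + of_int k) \<noteq> 0"
        then have "x + of_int m \<in> S" "(x + of_int m) + of_int (k - m) \<in> S"
          using supp by auto
        then show "int p dvd k - m" using S unfolding residue_separated_def by blast
      qed simp
      finally show ?thesis by simp
    qed simp
  qed
  also have "\<dots> = energy (periodic_interval_measure p) (ft f)"
    by (rule energy_fibre_formula[OF p f M, symmetric])
  finally show ?thesis ..
qed

text \<open>A substitute for the triangle inequality that is linear in the squared norms: for small \<open>\<delta>\<close> the first
  constant is close to 1, and for \<open>\<delta> = 1\<close> both are 2.\<close>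

lemma energy_add_le:
  assumes [measurable]: "f \<in> borel_measurable M" "g \<in> borel_measurable M" and \<delta>: "\<delta> > 0"
  shows "energy M (\<lambda>x. f x + g x) \<le> ennreal (1 + \<delta>) * energy M f + ennreal (1 + 1 / \<delta>) * energy M g"
proof -
  have "(cmod (f x + g x))\<^sup>2 \<le> (1 + \<delta>) * (cmod (f x))\<^sup>2 + (1 + 1 / \<delta>) * (cmod (g x))\<^sup>2" for x
  proof -
    let ?a = "cmod (f x)" and ?b = "cmod (g x)"
    have "(cmod (f x + g x))\<^sup>2 \<le> (?a + ?b)\<^sup>2" by (intro power_mono norm_triangle_ineq) auto
    moreover have "0 \<le> (\<delta> * ?a - ?b)\<^sup>2 / \<delta>" using \<delta> by simp
    moreover have "(\<delta> * ?a - ?b)\<^sup>2 / \<delta> = \<delta> * ?a\<^sup>2 - 2 * ?a * ?b + (1 / \<delta>) * ?b\<^sup>2"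
      using \<delta> by (simp add: power2_eq_square field_simps)
    moreover have "(?a + ?b)\<^sup>2 = ?a\<^sup>2 + 2 * ?a * ?b + ?b\<^sup>2" by (simp add: power2_sum)
    ultimately show ?thesis by (simp add: distrib_right)
  qed
  then have "energy M (\<lambda>x. f x + g x) \<le> (\<integral>\<^sup>+x. ennreal (1 + \<delta>) * ennreal ((cmod (f x))\<^sup>2) + ennreal (1 + 1 / \<delta>) * ennreal ((cmod (g x))\<^sup>2) \<partial>M)"
    unfolding energy_def using \<delta>
    by (intro nn_integral_mono) (simp add: ennreal_mult[symmetric] ennreal_plus[symmetric] del: ennreal_plus)
  also have "\<dots> = ennreal (1 + \<delta>) * energy M f + ennreal (1 + 1 / \<delta>) * energy M g"
    unfolding energy_def by (simp add: nn_integral_add nn_integral_cmult)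
  finally show ?thesis .
qed

text \<open>The Borel members of \<open>L1_L2_on S\<close>.\<close>

definition admissible :: "real set \<Rightarrow> (real \<Rightarrow> complex) \<Rightarrow> bool" where
  "admissible S f \<longleftrightarrow> f \<in> borel_measurable borel \<and> integrable lborel f \<and> energy lborel f < \<infinity> \<and>
     (\<forall>x. x \<notin> S \<longrightarrow> f x = 0)"

definition truncate :: "nat \<Rightarrow> (real \<Rightarrow> complex) \<Rightarrow> real \<Rightarrow> complex" where
  "truncate N f x = (if \<bar>x\<bar> \<le> real N \<and> cmod (f x) \<le> real N then f x else 0)"

lemma bounded_supported_truncate:
  assumes "f \<in> borel_measurable borel"
  shows "bounded_supported (truncate N f)"
  using assms by (intro bounded_supportedI[where B = "real N" and R = "real N"])
    (auto simp: truncate_def[abs_def] split: if_splits)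

lemma truncate_tendsto: "(\<lambda>N. truncate N f x) \<longlonglongrightarrow> f x"
proof -
  obtain K where K: "\<bar>x\<bar> \<le> real K" "cmod (f x) \<le> real K"
    by (metis max.bounded_iff real_arch_simple)
  have "\<forall>\<^sub>F N in sequentially. truncate N f x = f x"
    unfolding eventually_sequentially truncate_def using K by (intro exI[of _ K]) (auto intro: order_trans)
  then show ?thesis by (rule tendsto_eventually)
qed

lemma norm_truncate_le: "cmod (truncate N f x) \<le> cmod (f x)"
  by (simp add: truncate_def)

lemma norm_diff_truncate_le: "cmod (f x - truncate N f x) \<le> cmod (f x)"
  by (simp add: truncate_def)

lemma energy_mono: "(\<And>x. x \<in> space M \<Longrightarrow> cmod (f x) \<le> cmod (g x)) \<Longrightarrow> energy M f \<le> energy M g"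
  unfolding energy_def by (intro nn_integral_mono ennreal_leI power_mono) auto

lemma energy_tendsto:
  assumes [measurable]: "\<And>n. u n \<in> borel_measurable M" "v \<in> borel_measurable M" "w \<in> borel_measurable M"
    and "\<And>n x. x \<in> space M \<Longrightarrow> cmod (u n x) \<le> cmod (w x)" "energy M w < \<infinity>"
    and lim: "\<And>x. x \<in> space M \<Longrightarrow> (\<lambda>n. u n x) \<longlonglongrightarrow> v x"
  shows "(\<lambda>n. energy M (u n)) \<longlonglongrightarrow> energy M v"
  unfolding energy_def
proof (rule nn_integral_dominated_convergence[where w = "\<lambda>x. ennreal ((cmod (w x))\<^sup>2)"])
  show "AE x in M. (\<lambda>n. ennreal ((cmod (u n x))\<^sup>2)) \<longlonglongrightarrow> ennreal ((cmod (v x))\<^sup>2)"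
    by (intro AE_I2 tendsto_ennrealI tendsto_intros lim)
  show "AE x in M. ennreal ((cmod (u n x))\<^sup>2) \<le> ennreal ((cmod (w x))\<^sup>2)" for n
    using assms by (intro AE_I2 ennreal_leI power_mono) auto
qed (use assms in \<open>auto simp: energy_def\<close>)

lemma integrable_mult_phase:
  assumes "integrable lborel f"
  shows "integrable lborel (\<lambda>x. f x * phase (c * x))"
proof -
  have [measurable]: "f \<in> borel_measurable borel" using borel_measurable_integrable[OF assms] by simp
  show ?thesis
    by (rule Bochner_Integration.integrable_bound[OF assms]) (auto simp: norm_mult)
qed

lemma ft_diff:
  assumes "integrable lborel f" "integrable lborel g"
  shows "ft (\<lambda>x. f x - g x) t = ft f t - ft g t"
  using integrable_mult_phase[OF assms(1), of "-t"] integrable_mult_phase[OF assms(2), of "-t"]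
  unfolding ft_def by (simp add: left_diff_distrib)

lemma admissible_truncate:
  assumes "admissible S f"
  shows "admissible S (truncate N f)"
proof -
  have f: "f \<in> borel_measurable borel" "energy lborel f < \<infinity>" "\<forall>x. x \<notin> S \<longrightarrow> f x = 0"
    using assms unfolding admissible_def by auto
  note b = bounded_supported_truncate[OF f(1), of N]
  have "energy lborel (truncate N f) \<le> energy lborel f"
    by (intro energy_mono norm_truncate_le)
  then show ?thesis
    unfolding admissible_def
    using b bounded_supported_borel[OF b] bounded_supported_integrable[OF b] f
    by (auto simp: truncate_def intro: le_less_trans)
qed

lemma admissible_diff:
  assumes f: "admissible S f" and g: "admissible S g"
  shows "admissible S (\<lambda>x. f x - g x)"
proof -
  have [measurable]: "f \<in> borel_measurable borel" "g \<in> borel_measurable borel"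
    using f g unfolding admissible_def by auto
  have "energy lborel (\<lambda>x. f x + - g x) \<le> ennreal (1 + 1) * energy lborel f + ennreal (1 + 1 / 1) * energy lborel (\<lambda>x. - g x)"
    by (rule energy_add_le) auto
  also have "energy lborel (\<lambda>x. - g x) = energy lborel g" by (simp add: energy_def)
  also have "ennreal (1 + 1) * energy lborel f + ennreal (1 + 1 / 1) * energy lborel g < \<infinity>"
    using f g unfolding admissible_def by (auto simp: ennreal_mult_less_top)
  finally show ?thesis using f g unfolding admissible_def by auto
qed

lemma ft_truncate_tendsto:
  assumes "integrable lborel f" "f \<in> borel_measurable borel"
  shows "(\<lambda>N. ft (truncate N f) t) \<longlonglongrightarrow> ft f t"
  unfolding ft_def
proof (rule integral_dominated_convergence[where w = "\<lambda>x. cmod (f x)"])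
  note [measurable] = assms(2) bounded_supported_borel[OF bounded_supported_truncate[OF assms(2)]]
  show "(\<lambda>x. f x * phase (- (t * x))) \<in> borel_measurable lborel"
    "\<And>N. (\<lambda>x. truncate N f x * phase (- (t * x))) \<in> borel_measurable lborel" by measurable
  show "integrable lborel (\<lambda>x. cmod (f x))" using assms(1) by simp
  show "AE x in lborel. (\<lambda>N. truncate N f x * phase (- (t * x))) \<longlonglongrightarrow> f x * phase (- (t * x))"
    by (intro AE_I2 tendsto_intros truncate_tendsto)
  show "AE x in lborel. norm (truncate N f x * phase (- (t * x))) \<le> cmod (f x)" for N
    using norm_truncate_le by (simp add: norm_mult)
qed

text \<open>Truncations reduce the claim to bounded functions of bounded support. Fatou's lemma gives that
  the transform does not increase the energy of any admissible function; applied to \<open>f - truncate N f\<close>,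
  this lets the equality for truncations pass to the limit.\<close>

lemma isometry:
  assumes p: "p \<ge> 2" and S: "residue_separated p S" and f: "admissible S f"
  shows "energy (periodic_interval_measure p) (ft f) = energy lborel f"
proof -
  let ?\<mu> = "periodic_interval_measure p"
  have bounded: "energy ?\<mu> (ft (truncate N g)) = energy lborel (truncate N g)" if "admissible S g" for N g
    using that unfolding admissible_def
    by (intro isometry_bounded_supported[OF p _ S] bounded_supported_truncate) (auto simp: truncate_def)
  have contraction: "energy ?\<mu> (ft g) \<le> energy lborel g" if g: "admissible S g" for g
  proof -
    have [measurable]: "g \<in> borel_measurable borel" and gi: "integrable lborel g"
      using g unfolding admissible_def by auto
    note [measurable] = bounded_supported_borel[OF bounded_supported_truncate[of g]]
    have "energy ?\<mu> (ft g) = (\<integral>\<^sup>+t. liminf (\<lambda>N. ennreal ((cmod (ft (truncate N g) t))\<^sup>2)) \<partial>?\<mu>)"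
      unfolding energy_def
    proof (rule nn_integral_cong)
      fix t
      have "(\<lambda>N. ennreal ((cmod (ft (truncate N g) t))\<^sup>2)) \<longlonglongrightarrow> ennreal ((cmod (ft g t))\<^sup>2)"
        by (intro tendsto_ennrealI tendsto_intros ft_truncate_tendsto gi) measurable
      then show "ennreal ((cmod (ft g t))\<^sup>2) = liminf (\<lambda>N. ennreal ((cmod (ft (truncate N g) t))\<^sup>2))"
        by (rule lim_imp_Liminf[OF trivial_limit_sequentially, symmetric])
    qed
    also have "\<dots> \<le> liminf (\<lambda>N. energy ?\<mu> (ft (truncate N g)))"
      unfolding energy_def by (rule nn_integral_liminf) measurable
    also have "\<dots> \<le> energy lborel g"
    proof -
      have "energy ?\<mu> (ft (truncate N g)) \<le> energy lborel g" for N
        unfolding bounded[OF g] by (intro energy_mono norm_truncate_le)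
      then have "liminf (\<lambda>N. energy ?\<mu> (ft (truncate N g))) \<le> liminf (\<lambda>N::nat. energy lborel g)"
        by (intro Liminf_mono) simp
      then show ?thesis by (simp add: Liminf_const)
    qed
    finally show ?thesis .
  qed
  have [measurable]: "f \<in> borel_measurable borel" and fi: "integrable lborel f" and fe: "energy lborel f < \<infinity>"
    using f unfolding admissible_def by auto
  note [measurable] = bounded_supported_borel[OF bounded_supported_truncate[of f]]
  show ?thesis
  proof (rule antisym[OF contraction[OF f]])
    have *: "energy lborel f \<le> ennreal (1 + \<delta>) * energy ?\<mu> (ft f)" if \<delta>: "\<delta> > 0" for \<delta>
    proof (rule LIMSEQ_le)
      have "(\<lambda>N. energy lborel (\<lambda>x. f x - truncate N f x)) \<longlonglongrightarrow> energy lborel (\<lambda>x. f x - f x)"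
      proof (rule energy_tendsto[where w = f])
        show "(\<lambda>N. f x - truncate N f x) \<longlonglongrightarrow> f x - f x" for x
          by (intro tendsto_intros truncate_tendsto)
      qed (use fe norm_diff_truncate_le in auto)
      then have "(\<lambda>N. energy lborel (\<lambda>x. f x - truncate N f x)) \<longlonglongrightarrow> 0"
        by (simp add: energy_def)
      then have "(\<lambda>N. ennreal (1 + 1 / \<delta>) * energy lborel (\<lambda>x. f x - truncate N f x)) \<longlonglongrightarrow> ennreal (1 + 1 / \<delta>) * 0"
        by (intro ennreal_tendsto_cmult) auto
      then show "(\<lambda>N. ennreal (1 + \<delta>) * energy ?\<mu> (ft f) + ennreal (1 + 1 / \<delta>) * energy lborel (\<lambda>x. f x - truncate N f x))
          \<longlonglongrightarrow> ennreal (1 + \<delta>) * energy ?\<mu> (ft f)"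
        using tendsto_add[OF tendsto_const] by fastforce
      show "(\<lambda>N. energy lborel (truncate N f)) \<longlonglongrightarrow> energy lborel f"
        by (rule energy_tendsto[where w = f]) (use fe truncate_tendsto norm_truncate_le in auto)
      have "energy lborel (truncate N f) \<le> ennreal (1 + \<delta>) * energy ?\<mu> (ft f) + ennreal (1 + 1 / \<delta>) * energy lborel (\<lambda>x. f x - truncate N f x)" for N
      proof -
        let ?r = "\<lambda>x. f x - truncate N f x"
        have "admissible S ?r" by (intro admissible_diff admissible_truncate f)
        note r = contraction[OF this]
        have "energy lborel (truncate N f) = energy ?\<mu> (ft (truncate N f))" by (rule bounded[OF f, symmetric])
        also have "ft (truncate N f) = (\<lambda>t. ft f t + - ft ?r t)"
          using f admissible_truncate[OF f, of N] by (simp add: ft_diff admissible_def)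
        also have "energy ?\<mu> \<dots> \<le> ennreal (1 + \<delta>) * energy ?\<mu> (ft f) + ennreal (1 + 1 / \<delta>) * energy ?\<mu> (\<lambda>t. - ft ?r t)"
          by (rule energy_add_le[OF _ _ \<delta>]) measurable
        also have "energy ?\<mu> (\<lambda>t. - ft ?r t) = energy ?\<mu> (ft ?r)" by (simp add: energy_def)
        finally have *: "energy lborel (truncate N f) \<le> ennreal (1 + \<delta>) * energy ?\<mu> (ft f) + ennreal (1 + 1 / \<delta>) * energy ?\<mu> (ft ?r)" .
        show ?thesis by (rule order_trans[OF * add_left_mono[OF mult_left_mono[OF r]]]) simp
      qed
      then show "\<exists>N. \<forall>n\<ge>N. energy lborel (truncate n f) \<le> ennreal (1 + \<delta>) * energy ?\<mu> (ft f) + ennreal (1 + 1 / \<delta>) * energy lborel (\<lambda>x. f x - truncate n f x)"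
        by blast
    qed
    have fin: "energy ?\<mu> (ft f) < \<infinity>" using contraction[OF f] fe by (rule le_less_trans)
    show "energy lborel f \<le> energy ?\<mu> (ft f)"
    proof (rule LIMSEQ_le_const)
      have "(\<lambda>n. energy ?\<mu> (ft f) * ennreal (1 + 1 / real (Suc n))) \<longlonglongrightarrow> energy ?\<mu> (ft f) * ennreal (1 + 0)"
        using fin by (intro ennreal_tendsto_cmult tendsto_ennrealI tendsto_add tendsto_const LIMSEQ_Suc lim_1_over_n) auto
      then show "(\<lambda>n. energy ?\<mu> (ft f) * ennreal (1 + 1 / real (Suc n))) \<longlonglongrightarrow> energy ?\<mu> (ft f)"
        by simp
      show "\<exists>N. \<forall>n\<ge>N. energy lborel f \<le> energy ?\<mu> (ft f) * ennreal (1 + 1 / real (Suc n))"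
      proof (intro exI allI impI)
        fix n :: nat
        show "energy lborel f \<le> energy ?\<mu> (ft f) * ennreal (1 + 1 / real (Suc n))"
          unfolding mult.commute[of "energy ?\<mu> (ft f)"] by (rule *) simp
      qed
    qed
  qed
qed

section \<open>Spectral pairs in terms of Borel functions\<close>

lemma energy_completion: "energy (completion M) f = energy M f"
  unfolding energy_def by (rule nn_integral_completion)

lemma L2_iff: "f \<in> L2 M \<longleftrightarrow> f \<in> borel_measurable M \<and> energy M f < \<infinity>"
  unfolding L2_def energy_def by (auto simp: integrable_iff_bounded)

lemma L2_norm_eq:
  assumes "f \<in> borel_measurable M"
  shows "L2_norm M f = sqrt (enn2real (energy M f))"
proof -
  note assms[measurable]
  have "(LINT x|M. (cmod (f x))\<^sup>2) = enn2real (\<integral>\<^sup>+x. ennreal ((cmod (f x))\<^sup>2) \<partial>M)"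
    by (intro integral_eq_nn_integral) auto
  then show ?thesis unfolding L2_norm_def energy_def by simp
qed

lemma exp_eq_phase: "exp (- 2 * of_real pi * \<i> * of_real t * of_real x) = phase (- (t * x))"
  unfolding phase_def cis_conv_exp by (simp add: mult_ac)

lemma fourier_eq_ft:
  assumes "g \<in> borel_measurable borel" and "AE x in lebesgue. f x = g x"
    and "f \<in> borel_measurable lebesgue"
  shows "fourier f = ft g"
proof
  fix t
  note assms(1,3)[measurable]
  have ph[measurable]: "(\<lambda>x. phase (- (t * x))) \<in> borel_measurable lebesgue"
    by (intro measurable_completion) simp
  have gl[measurable]: "g \<in> borel_measurable lebesgue"
    by (intro measurable_completion) simp
  have "fourier f t = (LINT x|lebesgue. f x * phase (- (t * x)))"
    unfolding fourier_def exp_eq_phase ..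
  also have "\<dots> = (LINT x|lebesgue. g x * phase (- (t * x)))"
    using assms(2) by (intro integral_cong_AE) auto
  also have "\<dots> = ft g t"
    unfolding ft_def by (intro integral_completion) simp
  finally show "fourier f t = ft g t" .
qed

lemma admissible_imp_L1_L2_on:
  assumes "admissible S f"
  shows "f \<in> L1_L2_on S" "fourier f = ft f"
proof -
  have f: "f \<in> borel_measurable borel" "integrable lborel f" "energy lborel f < \<infinity>" "\<forall>x. x \<notin> S \<longrightarrow> f x = 0"
    using assms unfolding admissible_def by auto
  have fl: "f \<in> borel_measurable lebesgue"
    using f(1) by (intro measurable_completion) simp
  have "integrable lebesgue f"
    using f(1,2) by (subst integrable_completion) auto
  then show "f \<in> L1_L2_on S"
    unfolding L1_L2_on_def L2_iff using fl f by (auto simp: energy_completion)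
  show "fourier f = ft f" by (rule fourier_eq_ft) (use f fl in auto)
qed

text \<open>A Lebesgue measurable function agrees almost everywhere with a Borel one. Multiplication by the
  indicator of \<open>S\<close> restores the vanishing outside \<open>S\<close>.\<close>

lemma L1_L2_on_representative:
  assumes S: "S \<in> sets borel" and f: "f \<in> L1_L2_on S"
  shows "\<exists>g. admissible S g \<and> fourier f = ft g \<and> energy lebesgue f = energy lborel g"
proof -
  have fi: "integrable lebesgue f" and fe: "energy lebesgue f < \<infinity>" and f0: "\<And>x. x \<notin> S \<Longrightarrow> f x = 0"
    using f unfolding L1_L2_on_def L2_iff by auto
  have fl: "f \<in> borel_measurable lebesgue" using borel_measurable_integrable[OF fi] .
  have re: "(\<lambda>x. Re (f x)) \<in> borel_measurable lebesgue" and im: "(\<lambda>x. Im (f x)) \<in> borel_measurable lebesgue"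
    using fl by measurable
  obtain u where u: "u \<in> borel_measurable lborel" "AE x in lborel. Re (f x) = u x"
    using completion_ex_borel_measurable_real[OF re] by blast
  obtain v where v: "v \<in> borel_measurable lborel" "AE x in lborel. Im (f x) = v x"
    using completion_ex_borel_measurable_real[OF im] by blast
  define g where "g x = Complex (u x) (v x) * indicator S x" for x
  have uv[measurable]: "u \<in> borel_measurable borel" "v \<in> borel_measurable borel" using u v by auto
  note S[measurable]
  have g_eq: "g = (\<lambda>x. (of_real (u x) + \<i> * of_real (v x)) * indicator S x)"
    by (simp add: g_def fun_eq_iff complex_eq_iff)
  have gb[measurable]: "g \<in> borel_measurable borel"
    unfolding g_eq by measurable
  have ae: "AE x in lborel. f x = g x"
    using u(2) v(2)
  proof eventually_elim
    case (elim x)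
    then show ?case using f0[of x] by (auto simp: g_def complex_eq_iff indicator_def)
  qed
  have ael: "AE x in lebesgue. f x = g x" by (rule AE_completion[OF ae])
  have gl: "g \<in> borel_measurable lebesgue"
    by (intro measurable_completion) simp
  have "integrable lebesgue g"
    using integrable_cong_AE[OF fl gl ael] fi by simp
  then have gi: "integrable lborel g"
    by (subst (asm) integrable_completion) auto
  have e: "energy lebesgue f = energy lborel g"
    unfolding energy_completion unfolding energy_def using ae by (intro nn_integral_cong_AE) auto
  show ?thesis
  proof (intro exI[of _ g] conjI e fourier_eq_ft[OF gb ael fl])
    show "admissible S g"
      unfolding admissible_def using gi fe e by (auto simp: g_def)
  qed
qed

lemma energy_diff_finite:
  assumes [measurable]: "f \<in> borel_measurable M" "g \<in> borel_measurable M"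
    and "energy M f < \<infinity>" "energy M g < \<infinity>"
  shows "energy M (\<lambda>x. f x - g x) < \<infinity>"
proof -
  have "energy M (\<lambda>x. f x + - g x) \<le> ennreal (1 + 1) * energy M f + ennreal (1 + 1 / 1) * energy M (\<lambda>x. - g x)"
    by (rule energy_add_le) auto
  also have "energy M (\<lambda>x. - g x) = energy M g" by (simp add: energy_def)
  also have "ennreal (1 + 1) * energy M f + ennreal (1 + 1 / 1) * energy M g < \<infinity>"
    using assms by (auto simp: ennreal_mult_less_top)
  finally show ?thesis by simp
qed

definition isometric_on :: "nat \<Rightarrow> real set \<Rightarrow> bool" where
  "isometric_on p S \<longleftrightarrow> (\<forall>f. admissible S f \<longrightarrow> energy (periodic_interval_measure p) (ft f) = energy lborel f)"

text \<open>Membership of \<open>g\<close> in the closure of the range of the transform.\<close>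

definition approximable :: "nat \<Rightarrow> real set \<Rightarrow> (real \<Rightarrow> complex) \<Rightarrow> bool" where
  "approximable p S g \<longleftrightarrow> (\<forall>\<epsilon>>0. \<exists>f. admissible S f \<and>
     energy (periodic_interval_measure p) (\<lambda>t. ft f t - g t) < ennreal \<epsilon>)"

lemma spectral_pair_iff:
  assumes S: "S \<in> sets borel"
  shows "spectral_pair S (periodic_interval_measure p) \<longleftrightarrow> isometric_on p S \<and>
    (\<forall>g. g \<in> borel_measurable borel \<longrightarrow> energy (periodic_interval_measure p) g < \<infinity> \<longrightarrow> approximable p S g)"
    (is "?L \<longleftrightarrow> ?R")
proof
  let ?\<mu> = "periodic_interval_measure p"
  have sl: "S \<in> sets lebesgue" using S by (simp add: sets_completionI_sets)
  have ftm: "ft f \<in> borel_measurable ?\<mu>" if "admissible S f" for f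
    using that unfolding admissible_def by (auto intro: ft_borel cong: measurable_cong_sets)
  have meas: "g \<in> borel_measurable ?\<mu> \<longleftrightarrow> g \<in> borel_measurable borel" for g :: "real \<Rightarrow> complex"
    by (simp cong: measurable_cong_sets)
  {
    assume L: ?L
    have iso: "isometric_on p S"
      unfolding isometric_on_def
    proof (intro allI impI)
      fix f assume f: "admissible S f"
      note f' = admissible_imp_L1_L2_on[OF f]
      have fin: "energy ?\<mu> (ft f) < \<infinity>" "energy lborel f < \<infinity>"
        using L f f' unfolding spectral_pair_def L2_iff admissible_def by metis+
      have "L2_norm ?\<mu> (ft f) = L2_norm lebesgue f"
        using L f' unfolding spectral_pair_def by metis
      moreover have "f \<in> borel_measurable lebesgue"
        using f'(1) unfolding L1_L2_on_def by auto
      ultimately have "enn2real (energy ?\<mu> (ft f)) = enn2real (energy lborel f)"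
        using ftm[OF f] by (simp add: L2_norm_eq energy_completion)
      then show "energy ?\<mu> (ft f) = energy lborel f"
        using fin by (metis ennreal_enn2real infinity_ennreal_def)
    qed
    moreover have "approximable p S g" if g: "g \<in> borel_measurable borel" "energy ?\<mu> g < \<infinity>" for g
      unfolding approximable_def
    proof (intro allI impI)
      fix \<epsilon> :: real assume \<epsilon>: "\<epsilon> > 0"
      have "g \<in> L2 ?\<mu>" using g by (simp add: L2_iff meas)
      then obtain f where f: "f \<in> L1_L2_on S" "L2_norm ?\<mu> (\<lambda>t. fourier f t - g t) < sqrt \<epsilon>"
        using L \<epsilon> unfolding spectral_pair_def by (metis real_sqrt_gt_zero)
      obtain h where h: "admissible S h" "fourier f = ft h"
        using L1_L2_on_representative[OF S f(1)] by blast
      have m: "(\<lambda>t. ft h t - g t) \<in> borel_measurable ?\<mu>"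
        using ftm[OF h(1)] g(1) by (simp add: meas)
      have "energy ?\<mu> (ft h) < \<infinity>"
        using iso h(1) unfolding isometric_on_def admissible_def by metis
      then have fin: "energy ?\<mu> (\<lambda>t. ft h t - g t) < \<infinity>"
        using ftm[OF h(1)] g by (intro energy_diff_finite) (auto simp: meas)
      have "enn2real (energy ?\<mu> (\<lambda>t. ft h t - g t)) < \<epsilon>"
        using f(2) unfolding h(2) L2_norm_eq[OF m] by simp
      then have "ennreal (enn2real (energy ?\<mu> (\<lambda>t. ft h t - g t))) < ennreal \<epsilon>"
        by (intro ennreal_lessI) (use \<epsilon> in auto)
      then have "energy ?\<mu> (\<lambda>t. ft h t - g t) < ennreal \<epsilon>"
        using fin by (metis ennreal_enn2real infinity_ennreal_def)
      then show "\<exists>f. admissible S f \<and> energy ?\<mu> (\<lambda>t. ft f t - g t) < ennreal \<epsilon>"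
        using h(1) by blast
    qed
    ultimately show ?R by blast
  }
  {
    assume R: ?R
    then have iso: "energy ?\<mu> (ft f) = energy lborel f" if "admissible S f" for f
      using that unfolding isometric_on_def by blast
    show ?L
      unfolding spectral_pair_def
    proof (intro conjI ballI allI impI)
      show "S \<in> sets lebesgue" by (rule sl)
      show "radon_measure ?\<mu>" by (rule radon_periodic_interval_measure)
    next
      fix f assume f: "f \<in> L1_L2_on S"
      obtain h where h: "admissible S h" "fourier f = ft h" "energy lebesgue f = energy lborel h"
        using L1_L2_on_representative[OF S f] by blast
      have fin: "energy lborel h < \<infinity>" using h(1) unfolding admissible_def by blast
      show "fourier f \<in> L2 ?\<mu>"
        using fin ftm[OF h(1)] unfolding h(2) L2_iff iso[OF h(1)] by blast
      have "f \<in> borel_measurable lebesgue" using f unfolding L1_L2_on_def by auto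
      then show "L2_norm ?\<mu> (fourier f) = L2_norm lebesgue f"
        using h ftm[OF h(1)] iso[OF h(1)] by (simp add: L2_norm_eq)
    next
      fix g and \<epsilon> :: real assume g: "g \<in> L2 ?\<mu>" and \<epsilon>: "\<epsilon> > 0"
      then have g': "g \<in> borel_measurable borel" "energy ?\<mu> g < \<infinity>" by (auto simp: L2_iff meas)
      moreover have "\<epsilon>\<^sup>2 > 0" using \<epsilon> by simp
      ultimately obtain f where f: "admissible S f" "energy ?\<mu> (\<lambda>t. ft f t - g t) < ennreal (\<epsilon>\<^sup>2)"
        using R unfolding approximable_def by blast
      have m: "(\<lambda>t. ft f t - g t) \<in> borel_measurable ?\<mu>"
        using ftm[OF f(1)] g'(1) by (simp add: meas)
      have "enn2real (energy ?\<mu> (\<lambda>t. ft f t - g t)) < \<epsilon>\<^sup>2"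
        using f(2) \<epsilon> by (cases "energy ?\<mu> (\<lambda>t. ft f t - g t)") (auto simp: ennreal_less_iff)
      then have "sqrt (enn2real (energy ?\<mu> (\<lambda>t. ft f t - g t))) < \<epsilon>"
        using \<epsilon> by (metis abs_of_pos real_sqrt_abs real_sqrt_less_iff)
      then have "L2_norm ?\<mu> (\<lambda>t. fourier f t - g t) < \<epsilon>"
        unfolding admissible_imp_L1_L2_on(2)[OF f(1)] L2_norm_eq[OF m] .
      then show "\<exists>f\<in>L1_L2_on S. L2_norm ?\<mu> (\<lambda>t. fourier f t - g t) < \<epsilon>"
        using admissible_imp_L1_L2_on(1)[OF f(1)] by blast
    qed
  }
qed

section \<open>Isometry forces fibres into residue classes\<close>

text \<open>If \<open>x\<close> and \<open>x + d\<close> lie in the open set, so do a short interval \<open>E\<close> at \<open>x\<close> and its translate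
  \<open>E'\<close> by \<open>d\<close>. The nonempty fibres of the support of \<open>indicator E + indicator E'\<close> consist of two
  points at distance \<open>d\<close>, and isometry forces \<open>cell_kernel p d = 0\<close>.\<close>

lemma isometric_on_open_imp_residue_separated:
  assumes p: "p \<ge> 2" and S: "open S" and iso: "isometric_on p S"
  shows "residue_separated p S"
  unfolding residue_separated_def
proof (intro allI impI)
  fix x :: real and d :: int assume x: "x \<in> S" and xd: "x + of_int d \<in> S"
  show "int p dvd d"
  proof (cases "d = 0")
    case False
    obtain r1 where r1: "r1 > 0" "\<And>y. dist y x < r1 \<Longrightarrow> y \<in> S"
      using S x unfolding open_dist by metis
    obtain r2 where r2: "r2 > 0" "\<And>y. dist y (x + of_int d) < r2 \<Longrightarrow> y \<in> S"
      using S xd unfolding open_dist by metis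
    define \<delta> where "\<delta> = min (1 / 2) (min (r1 / 2) (r2 / 2))"
    have \<delta>: "\<delta> > 0" "\<delta> < 1" "\<delta> < r1" "\<delta> < r2" using r1(1) r2(1) by (auto simp: \<delta>_def)
    define E where "E = {x..x + \<delta>}"
    define E' where "E' = {x + of_int d..x + of_int d + \<delta>}"
    have EE': "y \<in> E' \<longleftrightarrow> y - of_int d \<in> E" for y
      by (auto simp: E_def E'_def)
    have E_unique: "m = k" if "y + of_int m \<in> E" "y + of_int k \<in> E" for y and m k :: int
    proof -
      have "\<bar>real_of_int m - of_int k\<bar> < 1" using that \<delta> by (auto simp: E_def abs_less_iff)
      then show ?thesis by linarith
    qed
    define f :: "real \<Rightarrow> complex" where "f = (\<lambda>y. indicator E y + indicator E' y)"
    have bf: "bounded_supported f"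
      unfolding f_def E_def E'_def by (intro bounded_supported_add bounded_supported_indicator_Icc)
    note [measurable] = bounded_supported_borel[OF bf]
    have [measurable]: "E \<in> sets borel" by (simp add: E_def)
    have fS: "f y = 0" if "y \<notin> S" for y
    proof -
      have "y \<notin> E" using that r1(2)[of y] \<delta> by (auto simp: E_def dist_real_def)
      moreover have "y \<notin> E'" using that r2(2)[of y] \<delta> by (auto simp: E'_def dist_real_def)
      ultimately show ?thesis by (simp add: f_def)
    qed
    have "energy lborel f < \<infinity>"
      using energy_eq_integral[OF bounded_supported_integrable_square[OF bf]] by simp
    then have "admissible S f"
      unfolding admissible_def using bf fS by (auto simp: bounded_supported_integrable)
    then have iso_f: "energy (periodic_interval_measure p) (ft f) = energy lborel f"
      using iso unfolding isometric_on_def by blast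
    obtain M :: int where M: "\<And>y. y \<notin> {- of_int M..<of_int M} \<Longrightarrow> f y = 0"
      using bounded_supported_vanishes_off_interval[OF bf] by blast
    \<comment> \<open>\<open>W y\<close> is 1 or 0 according to whether the fibre of \<open>y\<close> meets \<open>E\<close>.\<close>
    define W where "W y = (\<integral>\<^sup>+n. indicator E (y + of_int n) \<partial>count_space (UNIV :: int set))" for y :: real
    have f_fibre: "f (y + of_int k) = (if k = m \<or> k = m + d then 1 else 0)" if m: "y + of_int m \<in> E" for y k m
    proof -
      have 1: "y + of_int k \<in> E \<longleftrightarrow> k = m" using m E_unique by blast
      have "y + of_int k \<in> E' \<longleftrightarrow> y + of_int (k - d) \<in> E" by (simp add: EE' algebra_simps)
      also have "\<dots> \<longleftrightarrow> k - d = m" using m E_unique by blast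
      finally have 2: "y + of_int k \<in> E' \<longleftrightarrow> k = m + d" by auto
      show ?thesis using False by (auto simp: f_def 1 2 indicator_def)
    qed
    have f_fibre0: "f (y + of_int k) = 0" if "\<And>m::int. y + of_int m \<notin> E" for y k
      using that[of k] that[of "k - d"] by (simp add: f_def EE' algebra_simps)
    have W1: "W y = 1" if m: "y + of_int m \<in> E" for y m
    proof -
      have "y + of_int n \<in> E \<longleftrightarrow> n = m" for n using m E_unique by blast
      then have "indicator E (y + of_int n) = (indicator {m} n :: ennreal)" for n
        by (simp add: indicator_def)
      then show ?thesis unfolding W_def by simp
    qed
    have W0: "W y = 0" if "\<And>m::int. y + of_int m \<notin> E" for y
      unfolding W_def using that by simp
    have W_int: "(\<integral>\<^sup>+y. indicator {0..<1} y * W y \<partial>lborel) = ennreal \<delta>"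
    proof -
      have "(\<integral>\<^sup>+y. indicator {0..<1} y * W y \<partial>lborel) = (\<integral>\<^sup>+y. indicator E y \<partial>lborel)"
        unfolding W_def by (rule nn_integral_fold_unit[symmetric]) measurable
      also have "\<dots> = emeasure lborel E" by simp
      also have "\<dots> = ennreal \<delta>" using \<delta> by (simp add: E_def)
      finally show ?thesis .
    qed
    have [measurable]: "W \<in> borel_measurable borel"
    proof -
      have "W = (\<lambda>y. \<Sum>k. indicator E (y + of_int (int_decode k)))"
        unfolding W_def nn_integral_count_space_nat[symmetric]
        by (intro ext nn_integral_bij_count_space[symmetric] bij_int_decode)
      then show ?thesis by simp
    qed
    have eL: "energy lborel f = 2 * ennreal \<delta>"
    proof -
      have "energy lborel f = (\<integral>\<^sup>+y. indicator {0..<1} y * (\<integral>\<^sup>+n. ennreal ((cmod (f (y + of_int n)))\<^sup>2) \<partial>count_space (UNIV :: int set)) \<partial>lborel)"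
        unfolding energy_def by (rule nn_integral_fold_unit) measurable
      also have "\<dots> = (\<integral>\<^sup>+y. 2 * (indicator {0..<1} y * W y) \<partial>lborel)"
      proof (rule nn_integral_cong)
        fix y :: real
        have "(\<integral>\<^sup>+n. ennreal ((cmod (f (y + of_int n)))\<^sup>2) \<partial>count_space (UNIV :: int set)) = 2 * W y"
        proof (cases "\<exists>m::int. y + of_int m \<in> E")
          case True
          then obtain m :: int where m: "y + of_int m \<in> E" by blast
          have "(\<integral>\<^sup>+n. ennreal ((cmod (f (y + of_int n)))\<^sup>2) \<partial>count_space (UNIV :: int set)) = (\<Sum>n\<in>{m, m + d}. ennreal ((cmod (f (y + of_int n)))\<^sup>2))"
            by (intro nn_integral_count_space') (auto simp: f_fibre[OF m])
          also have "\<dots> = 2" using False by (simp add: f_fibre[OF m])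
          finally show ?thesis by (simp add: W1[OF m])
        next
          case no: False
          then show ?thesis using f_fibre0[of y] W0[of y] by simp
        qed
        then show "indicator {0..<1} y * (\<integral>\<^sup>+n. ennreal ((cmod (f (y + of_int n)))\<^sup>2) \<partial>count_space (UNIV :: int set)) = 2 * (indicator {0..<1} y * W y)"
          by (simp add: mult_ac)
      qed
      also have "\<dots> = 2 * ennreal \<delta>" by (simp add: nn_integral_cmult W_int)
      finally show ?thesis .
    qed
    have e\<mu>: "energy (periodic_interval_measure p) (ft f) = ennreal (2 + 2 * cell_kernel p d) * ennreal \<delta>"
    proof -
      have "energy (periodic_interval_measure p) (ft f) = (\<integral>\<^sup>+y. indicator {0..<1} y * fibre_energy p {- M..<M} (\<lambda>m. f (y + of_int m)) \<partial>lborel)"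
        by (rule energy_fibre_formula[OF p bf M])
      also have "\<dots> = (\<integral>\<^sup>+y. ennreal (2 + 2 * cell_kernel p d) * (indicator {0..<1} y * W y) \<partial>lborel)"
      proof (rule nn_integral_cong)
        fix y :: real
        show "indicator {0..<1} y * fibre_energy p {- M..<M} (\<lambda>m. f (y + of_int m)) = ennreal (2 + 2 * cell_kernel p d) * (indicator {0..<1} y * W y)"
        proof (cases "y \<in> {0..<1}")
          case y: True
          have "fibre_energy p {- M..<M} (\<lambda>m. f (y + of_int m)) = ennreal (2 + 2 * cell_kernel p d) * W y"
          proof (cases "\<exists>m::int. y + of_int m \<in> E")
            case True
            then obtain m :: int where m: "y + of_int m \<in> E" by blast
            have in_T: "k \<in> {- M..<M}" if "k = m \<or> k = m + d" for k
            proof -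
              have "f (y + of_int k) \<noteq> 0" using that f_fibre[OF m, of k] by auto
              then have "y + of_int k \<in> {- of_int M..<of_int M}" using M by blast
              then show ?thesis using y by auto
            qed
            have "fibre_energy p {- M..<M} (\<lambda>m. f (y + of_int m)) = ennreal (2 + 2 * cell_kernel p d)"
              by (rule fibre_energy_two_points[OF p _ _ _ False]) (use in_T f_fibre[OF m] in auto)
            then show ?thesis by (simp add: W1[OF m])
          next
            case no: False
            then show ?thesis using f_fibre0[of y] W0[of y] by (simp add: fibre_energy_def)
          qed
          then show ?thesis using y by simp
        qed simp
      qed
      also have "\<dots> = ennreal (2 + 2 * cell_kernel p d) * ennreal \<delta>" by (simp add: nn_integral_cmult W_int)
      finally show ?thesis .
    qed
    have "ennreal (2 + 2 * cell_kernel p d) * ennreal \<delta> = ennreal 2 * ennreal \<delta>"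
      using iso_f eL e\<mu> by simp
    then have "ennreal (2 + 2 * cell_kernel p d) = ennreal 2"
      using \<delta>(1) unfolding mult.commute[of _ "ennreal \<delta>"] ennreal_mult_cancel_left by auto
    then have eq: "ennreal (2 + 2 * cell_kernel p d) = ennreal 2" by simp
    have "2 + 2 * cell_kernel p d = 2"
    proof (cases "2 + 2 * cell_kernel p d \<ge> 0")
      case True
      then show ?thesis using eq by (subst (asm) ennreal_inj) simp_all
    next
      case neg: False
      then have "ennreal (2 + 2 * cell_kernel p d) = 0" by (intro ennreal_neg) simp
      then show ?thesis using eq by simp
    qed
    then have "cell_kernel p d = 0" by simp
    then show ?thesis using cell_kernel_eq_0_iff[OF p False] by simp
  qed simp
qed

section \<open>Tilings by an interval of integers\<close>

text \<open>If the translates of \<open>F\<close> by \<open>0, \<dots>, p - 1\<close> tile the integers, then \<open>F\<close> is one residue class modulo \<open>p\<close>: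
  the point after the \<open>p\<close> integers covered by \<open>m \<in> F\<close> can only be covered as an element of \<open>F\<close>.\<close>

lemma integer_tiling_periodic:
  fixes F :: "int set" and p :: int
  assumes p: "p > 0" and cover: "\<And>n. \<exists>j. 0 \<le> j \<and> j < p \<and> n - j \<in> F"
    and disj: "\<forall>m d. m \<in> F \<longrightarrow> m + d \<in> F \<longrightarrow> 0 < d \<longrightarrow> \<not> d < p"
  shows "m \<in> F \<Longrightarrow> m + p * k \<in> F" and "m \<in> F \<Longrightarrow> m + d \<in> F \<Longrightarrow> p dvd d"
proof -
  have up: "m + p \<in> F" if m: "m \<in> F" for m
  proof -
    obtain j where j: "0 \<le> j" "j < p" "m + p - j \<in> F" using cover by blast
    \<comment> \<open>Unless \<open>j = 0\<close>, the elements \<open>m\<close> and \<open>m + (p - j)\<close> of \<open>F\<close> are too close.\<close>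
    have "m + (p - j) \<in> F" using j(3) by (simp add: algebra_simps)
    then have "\<not> 0 < j" using disj[rule_format, OF m, of "p - j"] j(2) by auto
    then have "j = 0" using j(1) by linarith
    then show ?thesis using j by simp
  qed
  have down: "m - p \<in> F" if m: "m \<in> F" for m
  proof -
    obtain j where j: "0 \<le> j" "j < p" "m - p - j \<in> F" using cover by blast
    have "m - j \<in> F" using up[OF j(3)] by simp
    then have "\<not> 0 < j" using disj[rule_format, of "m - j" j] m j(2) by auto
    then have "j = 0" using j(1) by linarith
    then show ?thesis using j by simp
  qed
  show period: "m + p * k \<in> F" if "m \<in> F" for m k
  proof (induction k rule: int_induct[where k = 0])
    case base
    then show ?case using that by simp
  next
    case (step1 i)
    then show ?case using up[of "m + p * i"] by (simp add: algebra_simps)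
  next
    case (step2 i)
    then show ?case using down[of "m + p * i"] by (simp add: algebra_simps)
  qed
  show "p dvd d" if m: "m \<in> F" and md: "m + d \<in> F"
  proof (rule ccontr)
    assume "\<not> p dvd d"
    then have "d mod p \<noteq> 0" by (simp add: dvd_eq_mod_eq_0)
    then have "0 < d mod p" "d mod p < p"
      using p pos_mod_sign[OF p, of d] pos_mod_bound[OF p, of d] by linarith+
    moreover have "(m + p * (d div p)) + d mod p = m + d" by simp
    ultimately show False using disj[rule_format, OF period[OF m, of "d div p"], of "d mod p"] md by simp
  qed
qed

text \<open>Some residue class modulo \<open>p\<close> lies entirely in the fibre of \<open>S\<close> through \<open>x\<close>.\<close>

definition full_fibre :: "nat \<Rightarrow> real set \<Rightarrow> real \<Rightarrow> bool" where
  "full_fibre p S x \<longleftrightarrow> (\<exists>j<p. \<forall>k::int. x - real j + real p * of_int k \<in> S)"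

lemma translates_Union_eq:
  "(\<Union>t\<in>real ` {0..<p}. (\<lambda>x. x + t) ` S) = {x. \<exists>j<p. x - real j \<in> S}"
proof (intro set_eqI iffI)
  fix x assume "x \<in> {x. \<exists>j<p. x - real j \<in> S}"
  then obtain j where j: "j < p" "x - real j \<in> S" by blast
  then have "x \<in> (\<lambda>x. x + real j) ` S" by (intro image_eqI[of _ _ "x - real j"]) auto
  then show "x \<in> (\<Union>t\<in>real ` {0..<p}. (\<lambda>x. x + t) ` S)" using j by auto
qed auto

lemma AE_lborel_translate:
  fixes P :: "real \<Rightarrow> bool"
  assumes "AE x in lborel. P x" and [measurable]: "Measurable.pred borel P"
  shows "AE x in lborel. P (x + c)"
  using AE_borel_affine[of 1 P c] assms by (simp add: add.commute)

text \<open>Almost every fibre is a tiling of the integers, hence a residue class. Since \<open>S\<close> is open, a coincidence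
  of \<open>S\<close> with a translate that happens almost nowhere happens nowhere.\<close>

lemma tiles_interval_imp:
  assumes p: "p \<ge> 2" and S: "open S" and t: "tiles S (real ` {0..<p}) UNIV"
  shows "residue_separated p S" and "AE x in lborel. full_fibre p S x"
proof -
  have [measurable]: "S \<in> sets borel" using S by simp
  define C where "C = {x. \<exists>j<p. x - real j \<in> S}"
  have [measurable]: "C \<in> sets borel" unfolding C_def by measurable
  have "sym_diff C UNIV \<in> null_sets lebesgue"
    using t unfolding tiles_def translates_Union_eq C_def by blast
  then have "AE x in lebesgue. x \<notin> sym_diff C UNIV" by (rule AE_not_in)
  then have "AE x in lborel. x \<in> C" by (simp add: AE_completion_iff)
  then have "AE x in lborel. x + of_int n \<in> C" for n :: int
    by (rule AE_lborel_translate) simp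
  then have cover: "AE x in lborel. \<forall>n::int. x + of_int n \<in> C"
    by (simp add: AE_all_countable)
  have small: False if "x \<in> S" "x + of_int d \<in> S" "0 < d" "d < int p" for x d
  proof -
    let ?I = "((\<lambda>x. x + real (nat d)) ` S) \<inter> ((\<lambda>x. x + real 0) ` S)"
    have "real (nat d) \<in> real ` {0..<p}" "real 0 \<in> real ` {0..<p}" "real (nat d) \<noteq> real 0"
      using that(3,4) p by (auto intro!: image_eqI[of _ _ "nat d"])
    then have "?I \<in> null_sets lebesgue" using t unfolding tiles_def by blast
    then have "negligible ?I" by (simp add: negligible_iff_null_sets)
    moreover have "open ?I"
      using open_translation[OF S, of "real (nat d)"] S by (simp add: add.commute open_Int)
    moreover have "x + of_int d \<in> ?I" using that by auto
    ultimately show False using open_not_negligible by blast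
  qed
  have fibre: "\<And>m k. x + of_int m \<in> S \<Longrightarrow> x + of_int (m + int p * k) \<in> S"
      "\<And>m d. x + of_int m \<in> S \<Longrightarrow> x + of_int (m + d) \<in> S \<Longrightarrow> int p dvd d"
    if x: "\<forall>n::int. x + of_int n \<in> C" for x
  proof -
    define F where "F = {m::int. x + of_int m \<in> S}"
    have cover': "\<exists>j. 0 \<le> j \<and> j < int p \<and> n - j \<in> F" for n
    proof -
      obtain j where "j < p" "x + of_int n - real j \<in> S" using x unfolding C_def by blast
      then show ?thesis unfolding F_def by (intro exI[of _ "int j"]) (simp add: algebra_simps)
    qed
    have disj: "\<forall>m d. m \<in> F \<longrightarrow> m + d \<in> F \<longrightarrow> 0 < d \<longrightarrow> \<not> d < int p"
      using small[of "x + of_int m" d for m d] by (auto simp: F_def add.assoc)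
    note * = integer_tiling_periodic[of "int p" F, OF _ cover' disj]
    show "x + of_int (m + int p * k) \<in> S" if "x + of_int m \<in> S" for m k
      using *(1)[of m k] p that unfolding F_def by simp
    show "int p dvd d" if "x + of_int m \<in> S" "x + of_int (m + d) \<in> S" for m d
      using *(2)[of m d] p that unfolding F_def by simp
  qed
  show "AE x in lborel. full_fibre p S x"
    using cover
  proof eventually_elim
    case (elim x)
    have "x \<in> C" using elim[rule_format, of 0] by simp
    then obtain j where j: "j < p" "x + of_int (- int j) \<in> S" unfolding C_def by auto
    have "x - real j + real p * of_int k \<in> S" for k :: int
      using fibre(1)[OF elim j(2), of k] by (simp add: algebra_simps)
    then show ?case unfolding full_fibre_def using j(1) by blast
  qed
  show "residue_separated p S"
    unfolding residue_separated_def
  proof (intro allI impI)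
    fix x :: real and d :: int assume x: "x \<in> S" "x + of_int d \<in> S"
    show "int p dvd d"
    proof (rule ccontr)
      assume nd: "\<not> int p dvd d"
      let ?U = "S \<inter> (\<lambda>x. - of_int d + x) ` S"
      have "open ?U" using S by (intro open_Int open_translation)
      moreover have "x \<in> ?U" using x by (auto intro!: image_eqI[of _ _ "x + of_int d"])
      moreover have "negligible ?U"
      proof -
        have "AE x in lborel. x \<notin> ?U"
          using cover
        proof eventually_elim
          case (elim x)
          then show ?case using fibre(2)[of x 0 d] nd by auto
        qed
        then have "AE x in lebesgue. x \<notin> ?U" by (rule AE_completion)
        moreover have "?U \<in> sets lebesgue" using \<open>open ?U\<close> by (intro sets_completionI_sets) simp
        ultimately have "?U \<in> null_sets lebesgue" by (simp add: AE_iff_null_sets)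
        then show ?thesis by (simp add: negligible_iff_null_sets)
      qed
      ultimately show False using open_not_negligible by blast
    qed
  qed
qed

section \<open>Dense range forces covering\<close>

text \<open>Each nonempty fibre is completed to the residue classes modulo \<open>p\<close> that it meets. An empty fibre is
  given a residue class that can be chosen measurably, that of the points whose integer part is
  divisible by \<open>p\<close>.\<close>

definition fill_fibres :: "nat \<Rightarrow> real set \<Rightarrow> real set" where
  "fill_fibres p S = {x. \<exists>k::int. x + real p * of_int k \<in> S} \<union>
     {x. int p dvd \<lfloor>x\<rfloor> \<and> (\<forall>n::int. x + of_int n \<notin> S)}"

lemma subset_fill_fibres: "S \<subseteq> fill_fibres p S"
  unfolding fill_fibres_def by (auto intro: exI[of _ 0])

lemma fill_fibres_borel [measurable]:
  assumes [measurable]: "S \<in> sets borel"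
  shows "fill_fibres p S \<in> sets borel"
  unfolding fill_fibres_def by measurable

lemma residue_separated_fill_fibres:
  assumes S: "residue_separated p S"
  shows "residue_separated p (fill_fibres p S)"
  unfolding residue_separated_def
proof (intro allI impI)
  fix x :: real and d :: int
  assume x: "x \<in> fill_fibres p S" and xd: "x + of_int d \<in> fill_fibres p S"
  have to_int: "y + real p * of_int k = y + of_int (int p * k)" for y k by simp
  consider "\<forall>n::int. x + of_int n \<notin> S" | "\<exists>n::int. x + of_int n \<in> S" by blast
  then show "int p dvd d"
  proof cases
    case 1
    then have "int p dvd \<lfloor>x\<rfloor>" using x unfolding fill_fibres_def to_int by blast
    moreover have "int p dvd \<lfloor>x + of_int d\<rfloor>"
    proof -
      have "(x + of_int d) + of_int (int p * k) \<notin> S" for k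
        using 1[rule_format, of "d + int p * k"] by (simp add: algebra_simps)
      then show ?thesis using xd unfolding fill_fibres_def to_int by blast
    qed
    moreover have "d = \<lfloor>x + of_int d\<rfloor> - \<lfloor>x\<rfloor>" by simp
    ultimately show ?thesis by (metis dvd_diff)
  next
    case 2
    then obtain n :: int where n: "x + of_int n \<in> S" by blast
    then have "(x + of_int d) + of_int (n - d) \<in> S" by simp
    then obtain k l :: int where k: "x + of_int (int p * k) \<in> S" and l: "(x + of_int d) + of_int (int p * l) \<in> S"
      using x xd n unfolding fill_fibres_def to_int by blast
    have "(x + of_int (int p * k)) + of_int (d + int p * (l - k)) = (x + of_int d) + of_int (int p * l)"
      by (simp add: algebra_simps)
    then have "int p dvd d + int p * (l - k)"
      using S k l unfolding residue_separated_def by metis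
    then show ?thesis using dvd_add_left_iff[of "int p" "int p * (l - k)" d] by simp
  qed
qed

lemma fill_fibres_cover:
  assumes p: "p \<ge> 2"
  shows "\<exists>j<p. x - real j \<in> fill_fibres p S"
proof -
  have split: "\<exists>j<p. \<exists>k. n = int p * k + int j" for n :: int
    using p by (intro exI[of _ "nat (n mod int p)"] conjI exI[of _ "n div int p"])
      (auto simp: nat_less_iff)
  show ?thesis
  proof (cases "\<exists>n::int. x + of_int n \<in> S")
    case True
    then obtain n :: int where n: "x + of_int n \<in> S" by blast
    obtain j k where j: "j < p" "- n = int p * k + int j" using split[of "- n"] by blast
    have "n = - int j + int p * (- k)" using j(2) by (simp add: algebra_simps)
    then have "(x - real j) + real p * of_int (- k) = x + of_int n" by simp
    then have "(x - real j) + real p * of_int (- k) \<in> S" using n by (simp only:)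
    then have "x - real j \<in> fill_fibres p S" unfolding fill_fibres_def by blast
    then show ?thesis using j(1) by blast
  next
    case False
    obtain j k where j: "j < p" "\<lfloor>x\<rfloor> = int p * k + int j" using split[of "\<lfloor>x\<rfloor>"] by blast
    have "\<lfloor>x - real j\<rfloor> = \<lfloor>x\<rfloor> - int j" by (simp add: floor_diff_of_int[of x "int j", simplified])
    then have "int p dvd \<lfloor>x - real j\<rfloor>" using j(2) by simp
    moreover have "(x - real j) + of_int n \<notin> S" for n :: int
    proof -
      have "(x - real j) + of_int n = x + of_int (n - int j)" by simp
      then show ?thesis using False by metis
    qed
    ultimately show ?thesis using j(1) unfolding fill_fibres_def by blast
  qed
qed

lemma admissible_mono: "admissible S f \<Longrightarrow> S \<subseteq> S' \<Longrightarrow> admissible S' f"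
  unfolding admissible_def by blast

text \<open>The transform is still isometric on the larger set \<open>fill_fibres p S\<close>. So the transform of a function
  supported on the points that were added is orthogonal to the range of the transform on \<open>S\<close>, which is
  dense; such a function vanishes almost everywhere.\<close>

lemma complete_imp_fibres_filled:
  assumes p: "p \<ge> 2" and [measurable]: "S \<in> sets borel" and sep: "residue_separated p S"
    and dense: "\<And>g. g \<in> borel_measurable borel \<Longrightarrow> energy (periodic_interval_measure p) g < \<infinity> \<Longrightarrow> approximable p S g"
  shows "AE x in lborel. x \<notin> fill_fibres p S - S"
proof -
  let ?S' = "fill_fibres p S"
  note sep' = residue_separated_fill_fibres[OF sep]
  have "AE x in lborel. x \<notin> (?S' - S) \<inter> {- real N..real N}" for N :: nat
  proof -
    define E where "E = (?S' - S) \<inter> {- real N..real N}"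
    have [measurable]: "E \<in> sets borel" unfolding E_def by measurable
    have bf: "bounded_supported (indicator E)"
      by (rule bounded_supportedI[where B = 1 and R = "real N"]) (auto simp: E_def indicator_def abs_le_iff)
    note [measurable] = bounded_supported_borel[OF bf]
    define f :: "real \<Rightarrow> complex" where "f = indicator E"
    have fin: "energy lborel f < \<infinity>"
      using energy_eq_integral[OF bounded_supported_integrable_square[OF bf]] by (simp add: f_def)
    have f: "admissible ?S' f"
      unfolding admissible_def f_def using bounded_supported_integrable[OF bf] fin
      by (auto simp: f_def E_def indicator_def)
    have "energy lborel f = 0"
    proof (rule ccontr)
      assume ne: "energy lborel f \<noteq> 0"
      \<comment> \<open>No function on \<open>S\<close> has a transform at squared distance less than \<open>\<epsilon>\<close> from that of \<open>f\<close>.\<close>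
      define \<epsilon> where "\<epsilon> = enn2real (energy lborel f)"
      have \<epsilon>: "\<epsilon> > 0" "ennreal \<epsilon> = energy lborel f"
        using ne fin by (auto simp: \<epsilon>_def enn2real_positive_iff zero_less_iff_neq_zero)
      have "approximable p S (ft f)"
        using isometry[OF p sep' f] fin by (intro dense) (auto simp: f_def)
      then obtain h where h: "admissible S h" "energy (periodic_interval_measure p) (\<lambda>t. ft h t - ft f t) < ennreal \<epsilon>"
        using \<epsilon>(1) unfolding approximable_def by blast
      have h': "admissible ?S' h" using h(1) subset_fill_fibres by (rule admissible_mono)
      have "energy lborel f \<le> energy lborel (\<lambda>x. h x - f x)"
      proof (rule energy_mono)
        fix x
        show "cmod (f x) \<le> cmod (h x - f x)"
          using h(1) by (auto simp: f_def indicator_def E_def admissible_def)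
      qed
      also have "\<dots> = energy (periodic_interval_measure p) (ft (\<lambda>x. h x - f x))"
        by (rule isometry[OF p sep' admissible_diff[OF h' f], symmetric])
      also have "ft (\<lambda>x. h x - f x) = (\<lambda>t. ft h t - ft f t)"
        using h' f by (intro ext ft_diff) (auto simp: admissible_def)
      finally show False using h(2) \<epsilon>(2) by simp
    qed
    then have "AE x in lborel. ennreal ((cmod (f x))\<^sup>2) = 0"
      unfolding energy_def by (subst (asm) nn_integral_0_iff_AE) (auto simp: f_def)
    then show ?thesis
      unfolding E_def[symmetric] by eventually_elim (auto simp: f_def indicator_def split: if_splits)
  qed
  then have "AE x in lborel. \<forall>N::nat. x \<notin> (?S' - S) \<inter> {- real N..real N}"
    by (simp add: AE_all_countable)
  then show ?thesis
  proof eventually_elim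
    case (elim x)
    obtain N where "\<bar>x\<bar> \<le> real N" using real_arch_simple by blast
    then have "x \<in> {- real N..real N}" by (auto simp: abs_le_iff)
    then show ?case using elim by blast
  qed
qed

lemma complete_imp_tiles:
  assumes p: "p \<ge> 2" and S: "open S" and sep: "residue_separated p S"
    and dense: "\<And>g. g \<in> borel_measurable borel \<Longrightarrow> energy (periodic_interval_measure p) g < \<infinity> \<Longrightarrow> approximable p S g"
  shows "tiles S (real ` {0..<p}) UNIV"
  unfolding tiles_def translates_Union_eq
proof (intro conjI ballI impI)
  have Sb[measurable]: "S \<in> sets borel" using S by simp
  show "S \<in> sets lebesgue" using Sb by (intro sets_completionI_sets) simp
  show "UNIV \<in> sets lebesgue" by simp
  show "countable (real ` {0..<p})" by simp
  show "(\<lambda>x. x + s) ` S \<inter> (\<lambda>x. x + t) ` S \<in> null_sets lebesgue"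
    if st: "s \<in> real ` {0..<p}" "t \<in> real ` {0..<p}" "s \<noteq> t" for s t
  proof -
    obtain i j where ij: "i < p" "j < p" "s = real i" "t = real j" "i \<noteq> j" using st by auto
    have "(\<lambda>x. x + s) ` S \<inter> (\<lambda>x. x + t) ` S = {}"
    proof (rule ccontr)
      assume "(\<lambda>x. x + s) ` S \<inter> (\<lambda>x. x + t) ` S \<noteq> {}"
      then obtain x y where xy: "x \<in> S" "y \<in> S" "x + real i = y + real j" using ij by auto
      then have "y = x + of_int (int i - int j)" by simp
      then have "int p dvd int i - int j"
        using sep xy unfolding residue_separated_def by metis
      then have "\<bar>int p\<bar> \<le> \<bar>int i - int j\<bar>"
        using ij(5) by (intro dvd_imp_le_int) auto
      then show False using ij(1,2) by linarith
    qed
    then show ?thesis by simp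
  qed
  define C where "C = {x. \<exists>j<p. x - real j \<in> S}"
  have [measurable]: "C \<in> sets borel" unfolding C_def by measurable
  have "fill_fibres p S - S \<in> sets borel" by (intro sets.Diff fill_fibres_borel Sb)
  then have D: "Measurable.pred borel (\<lambda>x. x \<notin> fill_fibres p S - S)" by measurable
  have "AE x in lborel. x + - real j \<notin> fill_fibres p S - S" for j
    using AE_lborel_translate[OF complete_imp_fibres_filled[OF p Sb sep dense] D] by blast
  then have "AE x in lborel. \<forall>j::nat. x + - real j \<notin> fill_fibres p S - S"
    by (simp add: AE_all_countable)
  then have "AE x in lborel. x \<in> C"
  proof eventually_elim
    case (elim x)
    then show ?case using fill_fibres_cover[OF p, of x S] by (auto simp: C_def)
  qed
  then have "AE x in lebesgue. x \<notin> sym_diff C UNIV"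
    by (intro AE_completion) simp
  moreover have "sym_diff C UNIV \<in> sets lebesgue" by (intro sets_completionI_sets) simp
  ultimately show "sym_diff {x. \<exists>j<p. x - real j \<in> S} UNIV \<in> null_sets lebesgue"
    unfolding C_def by (simp add: AE_iff_null_sets)
qed

section \<open>Covering forces dense range\<close>

lemma energy_periodic_interval_measure:
  assumes [measurable]: "g \<in> borel_measurable borel"
  shows "energy (periodic_interval_measure p) g = ennreal (real p) * energy lborel (\<lambda>t. g t * indicator (cells p) t)"
proof -
  have "energy (periodic_interval_measure p) g = (\<integral>\<^sup>+t. ennreal (real p) * ennreal ((cmod (g t * indicator (cells p) t))\<^sup>2) \<partial>lborel)"
    unfolding energy_def periodic_interval_measure_eq
    by (subst nn_integral_density) (auto intro!: nn_integral_cong simp: indicator_def)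
  then show ?thesis unfolding energy_def by (simp add: nn_integral_cmult)
qed

lemma energy_periodic_interval_measure_cong:
  assumes [measurable]: "g \<in> borel_measurable borel" "h \<in> borel_measurable borel"
    and "\<And>t. t \<in> cells p \<Longrightarrow> g t = h t"
  shows "energy (periodic_interval_measure p) g = energy (periodic_interval_measure p) h"
proof -
  have "(\<lambda>t. g t * indicator (cells p) t) = (\<lambda>t. h t * indicator (cells p) t)"
    using assms(3) by (auto simp: indicator_def)
  then show ?thesis by (simp add: energy_periodic_interval_measure)
qed

lemma energy_add_less:
  assumes [measurable]: "f \<in> borel_measurable M" "g \<in> borel_measurable M" and \<epsilon>: "\<epsilon> > 0"
    and less: "energy M f < ennreal (\<epsilon> / 4)" "energy M g < ennreal (\<epsilon> / 4)"
  shows "energy M (\<lambda>x. f x + g x) < ennreal \<epsilon>"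
proof -
  have less': "ennreal 2 * energy M f < ennreal 2 * ennreal (\<epsilon> / 4)" "ennreal 2 * energy M g < ennreal 2 * ennreal (\<epsilon> / 4)"
    by (rule ennreal_mult_strict_left_mono[OF less(1)]; simp) (rule ennreal_mult_strict_left_mono[OF less(2)]; simp)
  have "energy M (\<lambda>x. f x + g x) \<le> ennreal (1 + 1) * energy M f + ennreal (1 + 1 / 1) * energy M g"
    by (rule energy_add_le) auto
  also have "\<dots> = ennreal 2 * energy M f + ennreal 2 * energy M g" by simp
  also have "\<dots> < ennreal 2 * ennreal (\<epsilon> / 4) + ennreal 2 * ennreal (\<epsilon> / 4)"
    by (rule add_strict_mono[OF less'])
  also have "\<dots> = ennreal \<epsilon>"
    using \<epsilon> by (subst (1 2) ennreal_mult[symmetric]) (simp_all add: ennreal_plus[symmetric] del: ennreal_plus)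
  finally show ?thesis .
qed

lemma admissible_zero: "admissible S (\<lambda>x. 0)"
  by (simp add: admissible_def energy_def)

lemma approximable_limit:
  assumes g: "g \<in> borel_measurable borel"
    and near: "\<And>\<epsilon>. \<epsilon> > 0 \<Longrightarrow> \<exists>h. h \<in> borel_measurable borel \<and> approximable p S h \<and>
      energy (periodic_interval_measure p) (\<lambda>t. h t - g t) < ennreal \<epsilon>"
  shows "approximable p S g"
  unfolding approximable_def
proof (intro allI impI)
  let ?\<mu> = "periodic_interval_measure p"
  fix \<epsilon> :: real assume \<epsilon>: "\<epsilon> > 0"
  obtain h where h: "h \<in> borel_measurable borel" "approximable p S h" "energy ?\<mu> (\<lambda>t. h t - g t) < ennreal (\<epsilon> / 4)"
    using near[of "\<epsilon> / 4"] \<epsilon> by auto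
  obtain f where f: "admissible S f" "energy ?\<mu> (\<lambda>t. ft f t - h t) < ennreal (\<epsilon> / 4)"
    using h(2) \<epsilon> unfolding approximable_def by (metis divide_pos_pos zero_less_numeral)
  have [measurable]: "f \<in> borel_measurable borel" using f(1) unfolding admissible_def by blast
  note g[measurable] h(1)[measurable]
  have "energy ?\<mu> (\<lambda>t. (ft f t - h t) + (h t - g t)) < ennreal \<epsilon>"
    using f(2) h(3) by (intro energy_add_less \<epsilon>) auto
  then show "\<exists>f. admissible S f \<and> energy ?\<mu> (\<lambda>t. ft f t - g t) < ennreal \<epsilon>"
    using f(1) by (intro exI[of _ f]) simp
qed

lemma approximable_diff:
  assumes g: "g \<in> borel_measurable borel" "approximable p S g" and h: "h \<in> borel_measurable borel" "approximable p S h"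
  shows "approximable p S (\<lambda>t. g t - h t)"
  unfolding approximable_def
proof (intro allI impI)
  let ?\<mu> = "periodic_interval_measure p"
  fix \<epsilon> :: real assume \<epsilon>: "\<epsilon> > 0"
  obtain f1 where f1: "admissible S f1" "energy ?\<mu> (\<lambda>t. ft f1 t - g t) < ennreal (\<epsilon> / 4)"
    using g(2) \<epsilon> unfolding approximable_def by (metis divide_pos_pos zero_less_numeral)
  obtain f2 where f2: "admissible S f2" "energy ?\<mu> (\<lambda>t. ft f2 t - h t) < ennreal (\<epsilon> / 4)"
    using h(2) \<epsilon> unfolding approximable_def by (metis divide_pos_pos zero_less_numeral)
  have [measurable]: "f1 \<in> borel_measurable borel" "f2 \<in> borel_measurable borel"
    using f1(1) f2(1) unfolding admissible_def by blast+
  note g(1)[measurable] h(1)[measurable]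
  have "energy ?\<mu> (\<lambda>t. - (ft f2 t - h t)) = energy ?\<mu> (\<lambda>t. ft f2 t - h t)"
    unfolding energy_def norm_minus_cancel ..
  then have "energy ?\<mu> (\<lambda>t. (ft f1 t - g t) + - (ft f2 t - h t)) < ennreal \<epsilon>"
    using f1(2) f2(2) by (intro energy_add_less \<epsilon>) auto
  also have "(\<lambda>t. (ft f1 t - g t) + - (ft f2 t - h t)) = (\<lambda>t. ft (\<lambda>x. f1 x - f2 x) t - (g t - h t))"
    using f1(1) f2(1) by (intro ext) (simp add: ft_diff admissible_def)
  finally show "\<exists>f. admissible S f \<and> energy ?\<mu> (\<lambda>t. ft f t - (g t - h t)) < ennreal \<epsilon>"
    using admissible_diff[OF f1(1) f2(1)] by blast
qed

lemma approximable_zero: "approximable p S (\<lambda>t. 0)"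
  unfolding approximable_def
  by (intro allI impI exI[of _ "\<lambda>x. 0"]) (simp add: admissible_zero ft_def energy_def)

lemma approximable_add:
  assumes g: "g \<in> borel_measurable borel" "approximable p S g" and h: "h \<in> borel_measurable borel" "approximable p S h"
  shows "approximable p S (\<lambda>t. g t + h t)"
  using approximable_diff[OF g _ approximable_diff[OF _ approximable_zero h]] h(1) by simp

lemma approximable_sum:
  assumes "finite A" "\<And>i. i \<in> A \<Longrightarrow> g i \<in> borel_measurable borel" "\<And>i. i \<in> A \<Longrightarrow> approximable p S (g i)"
  shows "approximable p S (\<lambda>t. \<Sum>i\<in>A. g i t)"
  using assms
proof (induction A rule: finite_induct)
  case (insert i A)
  then show ?case by (simp add: approximable_add)
qed (simp add: approximable_zero)

lemma nn_integral_int_reindex_le: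
  fixes u :: "int \<Rightarrow> ennreal"
  assumes "inj h"
  shows "(\<integral>\<^sup>+k. u (h k) \<partial>count_space (UNIV :: int set)) \<le> (\<integral>\<^sup>+n. u n \<partial>count_space (UNIV :: int set))"
proof -
  have "(\<integral>\<^sup>+k. u (h k) \<partial>count_space (UNIV :: int set)) = (\<integral>\<^sup>+n. u n \<partial>count_space (range h))"
    using assms by (intro nn_integral_bij_count_space) (simp add: bij_betw_def)
  also have "\<dots> = (\<integral>\<^sup>+n. u n * indicator (range h) n \<partial>count_space UNIV)"
    by (subst nn_integral_count_space_indicator) auto
  also have "\<dots> \<le> (\<integral>\<^sup>+n. u n \<partial>count_space (UNIV :: int set))"
    by (intro nn_integral_mono) (auto simp: indicator_def)
  finally show ?thesis .
qed

lemma integral_periodic_interval_measure: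
  fixes u :: "real \<Rightarrow> complex"
  assumes [measurable]: "u \<in> borel_measurable borel" and supp: "\<And>t. t \<notin> cells p \<Longrightarrow> u t = 0"
  shows "(LINT t|periodic_interval_measure p. u t) = of_nat p * (LINT t|lborel. u t)"
proof -
  have "periodic_interval_measure p = density lborel (\<lambda>t. ennreal (real p * indicator (cells p) t))"
    unfolding periodic_interval_measure_eq by (simp add: ennreal_mult ennreal_indicator)
  then have "(LINT t|periodic_interval_measure p. u t) = (LINT t|lborel. (real p * indicator (cells p) t) *\<^sub>R u t)"
    by (simp add: integral_density)
  also have "\<dots> = (LINT t|lborel. of_nat p * u t)"
    using supp by (intro Bochner_Integration.integral_cong) (auto simp: indicator_def scaleR_conv_of_real)
  also have "\<dots> = of_nat p * (LINT t|lborel. u t)" by simp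
  finally show ?thesis .
qed

lemma integrable_energy_finite:
  assumes "f \<in> borel_measurable M" "energy M f < \<infinity>"
  shows "integrable M (\<lambda>x. (cmod (f x))\<^sup>2)"
  using assms L2_iff[of f M] unfolding L2_def by blast

lemma integrable_mult_cnj:
  assumes [measurable]: "f \<in> borel_measurable M" "g \<in> borel_measurable M"
    and e: "energy M f < \<infinity>" "energy M g < \<infinity>"
  shows "integrable M (\<lambda>x. f x * cnj (g x))"
proof (rule Bochner_Integration.integrable_bound)
  show "integrable M (\<lambda>x. (cmod (f x))\<^sup>2 + (cmod (g x))\<^sup>2)"
    by (intro Bochner_Integration.integrable_add integrable_energy_finite e) measurable
  show "(\<lambda>x. f x * cnj (g x)) \<in> borel_measurable M" by measurable
  show "AE x in M. norm (f x * cnj (g x)) \<le> norm ((cmod (f x))\<^sup>2 + (cmod (g x))\<^sup>2)"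
  proof (rule AE_I2)
    fix x
    have "2 * (cmod (f x) * cmod (g x)) \<le> (cmod (f x))\<^sup>2 + (cmod (g x))\<^sup>2"
      using sum_squares_bound[of "cmod (f x)" "cmod (g x)"] by simp
    moreover have "0 \<le> cmod (f x) * cmod (g x)" by simp
    ultimately have "cmod (f x) * cmod (g x) \<le> (cmod (f x))\<^sup>2 + (cmod (g x))\<^sup>2" by linarith
    then show "norm (f x * cnj (g x)) \<le> norm ((cmod (f x))\<^sup>2 + (cmod (g x))\<^sup>2)"
      by (simp add: norm_mult)
  qed
qed

text \<open>The adjoint of the transform is the inverse transform.\<close>

lemma ft_pairing:
  assumes f: "bounded_supported f" and g: "bounded_supported g"
  shows "(LINT t|lborel. ft f t * cnj (g t)) = (LINT x|lborel. f x * cnj (ft g (- x)))"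
proof -
  note [measurable] = bounded_supported_borel[OF f] bounded_supported_borel[OF g]
  note fi = bounded_supported_integrable[OF f] and gi = bounded_supported_integrable[OF g]
  define h where "h x t = f x * phase (- (t * x)) * cnj (g t)" for x t
  have nh: "norm (h x t) = cmod (f x) * cmod (g t)" for x t
    by (simp add: h_def norm_mult)
  have hi: "integrable (lborel \<Otimes>\<^sub>M lborel) (case_prod h)"
  proof (rule lborel_pair.Fubini_integrable)
    show "case_prod h \<in> borel_measurable (lborel \<Otimes>\<^sub>M lborel)"
      unfolding h_def by measurable
    show "integrable lborel (\<lambda>x. LINT t|lborel. norm (case_prod h (x, t)))"
      using fi by (simp add: nh integrable_norm)
    show "AE x in lborel. integrable lborel (\<lambda>t. case_prod h (x, t))"
    proof (rule AE_I2)
      fix x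
      have "integrable lborel (\<lambda>t. norm (f x) * norm (g t))"
        using gi by (intro integrable_mult_right integrable_norm)
      then show "integrable lborel (\<lambda>t. case_prod h (x, t))"
        by (rule Bochner_Integration.integrable_bound) (auto simp: h_def norm_mult)
    qed
  qed
  have "(LINT t|lborel. ft f t * cnj (g t)) = (LINT t|lborel. LINT x|lborel. h x t)"
    unfolding ft_def h_def by simp
  also have "\<dots> = (LINT x|lborel. LINT t|lborel. h x t)"
    by (rule lborel_pair.Fubini_integral[OF hi])
  also have "\<dots> = (LINT x|lborel. f x * cnj (ft g (- x)))"
  proof (intro Bochner_Integration.integral_cong refl)
    fix x
    have "(LINT t|lborel. h x t) = (LINT t|lborel. f x * cnj (g t * phase (- (- x * t))))"
      by (simp add: h_def mult_ac)
    also have "\<dots> = f x * (LINT t|lborel. cnj (g t * phase (- (- x * t))))"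
      by (rule integral_mult_right_zero)
    also have "\<dots> = f x * cnj (ft g (- x))"
      by (simp only: ft_def Bochner_Integration.integral_cnj)
    finally show "(LINT t|lborel. h x t) = f x * cnj (ft g (- x))" .
  qed
  finally show ?thesis .
qed

text \<open>Let \<open>F\<close> be the inverse transform of \<open>g\<close> with respect to the measure, and \<open>f R\<close> its restriction to
  \<open>S \<inter> [-R, R]\<close>. Pairing \<open>ft (f R)\<close> with \<open>g\<close> gives the energy of \<open>f R\<close> again, so the squared distance from
  \<open>ft (f R)\<close> to \<open>g\<close> is the energy of \<open>g\<close> minus that of \<open>f R\<close>. On a residue class \<open>y + p \<int>\<close> the values of \<open>F\<close>
  are the Fourier coefficients of \<open>g * phase (y \<cdot>)\<close> on a cell of length \<open>1 / p\<close>, so by Parseval's identity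
  their squares sum to the energy of \<open>g\<close>, whatever \<open>y\<close> is. As almost every fibre of \<open>S\<close> contains a
  residue class, the energy of \<open>F\<close> on \<open>S\<close> is at least that of \<open>g\<close>, and the distance tends to 0.\<close>

lemma approximable_single_cell:
  fixes n :: int
  assumes p: "p \<ge> 2" and Sb: "S \<in> sets borel" and sep: "residue_separated p S"
    and full: "AE x in lborel. full_fibre p S x"
    and g: "bounded_supported g" and supp: "\<And>t. t - of_int n \<notin> cell p \<Longrightarrow> g t = 0"
  shows "approximable p S g"
  unfolding approximable_def
proof (intro allI impI)
  let ?\<mu> = "periodic_interval_measure p"
  fix \<epsilon> :: real assume \<epsilon>: "\<epsilon> > 0"
  note [measurable] = bounded_supported_borel[OF g] Sb
  have supp': "g t = 0" if "t \<notin> cells p" for t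
    using that supp unfolding cells_def by blast
  have g\<mu>: "energy ?\<mu> g = ennreal (real p) * energy lborel g"
  proof -
    have "(\<lambda>t. g t * indicator (cells p) t) = g"
    proof
      show "g t * indicator (cells p) t = g t" for t using supp'[of t] by (cases "t \<in> cells p") auto
    qed
    then show ?thesis by (simp add: energy_periodic_interval_measure)
  qed
  define G where "G = real p * (LINT t|lborel. (cmod (g t))\<^sup>2)"
  have G: "energy ?\<mu> g = ennreal G" "G \<ge> 0"
    unfolding g\<mu> G_def energy_eq_integral[OF bounded_supported_integrable_square[OF g]]
    by (simp_all add: ennreal_mult)
  define F where "F x = of_nat p * ft g (- x)" for x
  have [measurable]: "F \<in> borel_measurable borel"
    unfolding F_def by measurable
  obtain B where B: "\<And>x. cmod (F x) \<le> B"
  proof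
    fix x
    have "cmod (ft g (- x)) \<le> (LINT t|lborel. cmod (g t * phase (- (- x * t))))"
      unfolding ft_def by (rule integral_norm_bound)
    then show "cmod (F x) \<le> real p * (LINT t|lborel. cmod (g t))"
      by (simp add: F_def norm_mult mult_left_mono)
  qed
  define f where "f R x = F x * indicator (S \<inter> {- real R..real R}) x" for R x
  have bf: "bounded_supported (f R)" for R
    unfolding f_def
    by (rule bounded_supportedI[where B = "\<bar>B\<bar>" and R = "real R"])
      (auto simp: indicator_def abs_le_iff intro: order_trans[OF B] split: if_splits)
  have af: "admissible S (f R)" for R
  proof -
    have "energy lborel (f R) < \<infinity>"
      using energy_eq_integral[OF bounded_supported_integrable_square[OF bf]] by simp
    then show ?thesis
      unfolding admissible_def using bounded_supported_borel[OF bf] bounded_supported_integrable[OF bf]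
      by (auto simp: f_def)
  qed
  define a where "a R = (LINT x|lborel. (cmod (f R x))\<^sup>2)" for R
  have a: "energy lborel (f R) = ennreal (a R)" "a R \<ge> 0" for R
    unfolding a_def by (auto intro: energy_eq_integral bounded_supported_integrable_square bf)
  have distance: "energy ?\<mu> (\<lambda>t. ft (f R) t - g t) = ennreal (G - a R)" for R
  proof -
    have [measurable]: "f R \<in> borel_measurable borel" by (rule bounded_supported_borel[OF bf])
    have e1: "energy ?\<mu> (ft (f R)) = ennreal (a R)"
      using isometry[OF p sep af] a(1) by simp
    have m: "ft (f R) \<in> borel_measurable ?\<mu>" "g \<in> borel_measurable ?\<mu>" by measurable
    have fin: "energy ?\<mu> (ft (f R)) < \<infinity>" "energy ?\<mu> g < \<infinity>" using e1 G by auto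
    note i = integrable_energy_finite[OF m(1) fin(1)] integrable_mult_cnj[OF m fin] integrable_energy_finite[OF m(2) fin(2)]
    have v1: "(LINT t|?\<mu>. (cmod (ft (f R) t))\<^sup>2) = a R"
      using e1 a(2)[of R] unfolding energy_eq_integral[OF i(1)] by (subst (asm) ennreal_inj) auto
    have v3: "(LINT t|?\<mu>. (cmod (g t))\<^sup>2) = G"
      using G unfolding energy_eq_integral[OF i(3)] by (subst (asm) ennreal_inj) auto
    have v2: "(LINT t|?\<mu>. ft (f R) t * cnj (g t)) = of_real (a R)"
    proof -
      have "(LINT t|?\<mu>. ft (f R) t * cnj (g t)) = of_nat p * (LINT t|lborel. ft (f R) t * cnj (g t))"
        using supp' by (intro integral_periodic_interval_measure) auto
      also have "\<dots> = of_nat p * (LINT x|lborel. f R x * cnj (ft g (- x)))"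
        by (simp add: ft_pairing[OF bf g])
      also have "\<dots> = (LINT x|lborel. of_nat p * (f R x * cnj (ft g (- x))))" by simp
      also have "\<dots> = (LINT x|lborel. f R x * cnj (f R x))"
        by (intro Bochner_Integration.integral_cong) (auto simp: f_def F_def indicator_def)
      also have "\<dots> = of_real (a R)"
        unfolding a_def by (rule integral_cmod_squared[OF bf, symmetric])
      finally show ?thesis .
    qed
    have "integrable ?\<mu> (\<lambda>t. (cmod (ft (f R) t - g t))\<^sup>2)"
      by (rule integrable_energy_finite) (use energy_diff_finite[OF m fin] in measurable)
    then have "energy ?\<mu> (\<lambda>t. ft (f R) t - g t) = ennreal (LINT t|?\<mu>. (cmod (ft (f R) t - g t))\<^sup>2)"
      by (rule energy_eq_integral)
    also have "(LINT t|?\<mu>. (cmod (ft (f R) t - g t))\<^sup>2) = G - a R"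
      unfolding integral_cmod_diff_squared[OF i] v1 v2 v3 by simp
    finally show ?thesis .
  qed
  have fibre: "(\<integral>\<^sup>+k. ennreal ((cmod (F (y + real p * of_int k)))\<^sup>2) \<partial>count_space (UNIV :: int set)) = ennreal G" for y
  proof -
    define h where "h t = g t * phase (y * t)" for t
    have bh: "bounded_supported h" unfolding h_def by (rule bounded_supported_phase[OF g])
    have h0: "h t = 0" if "t \<notin> {(of_int n - 1 / (2 * real p))..(of_int n - 1 / (2 * real p)) + 1 / real p}" for t
    proof -
      have "1 / real p = 1 / (2 * real p) + 1 / (2 * real p)" by (simp add: field_simps)
      then have "t - of_int n \<notin> cell p" using that unfolding cell_def by auto
      then show ?thesis by (simp add: h_def supp)
    qed
    have F_h: "F (y + real p * of_int k) = of_nat p * ft h (real p * of_int (- k))" for k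
    proof -
      have "phase (- (- (y + real p * of_int k) * t)) = phase (y * t) * phase (- (real p * of_int (- k) * t))" for t
        by (simp add: algebra_simps flip: phase_add)
      then show ?thesis unfolding F_def ft_def h_def by (simp add: mult_ac)
    qed
    have "(\<integral>\<^sup>+k. ennreal ((cmod (F (y + real p * of_int k)))\<^sup>2) \<partial>count_space (UNIV :: int set))
        = (\<integral>\<^sup>+k. ennreal ((real p)\<^sup>2) * ennreal ((cmod (ft h (real p * of_int (- k))))\<^sup>2) \<partial>count_space (UNIV :: int set))"
      unfolding F_h by (simp add: norm_mult power_mult_distrib ennreal_mult)
    also have "\<dots> = ennreal ((real p)\<^sup>2) * (\<integral>\<^sup>+k. ennreal ((cmod (ft h (real p * of_int (- k))))\<^sup>2) \<partial>count_space (UNIV :: int set))"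
      by (rule nn_integral_cmult) simp
    also have "(\<integral>\<^sup>+k. ennreal ((cmod (ft h (real p * of_int (- k))))\<^sup>2) \<partial>count_space (UNIV :: int set))
        = (\<integral>\<^sup>+k. ennreal ((cmod (ft h (real p * of_int k)))\<^sup>2) \<partial>count_space (UNIV :: int set))"
      by (rule nn_integral_bij_count_space[where g = uminus]) (rule bij_uminus)
    also have "ennreal ((real p)\<^sup>2) * \<dots> = ennreal (real p) * energy lborel h"
    proof -
      have "ennreal (real p) * (\<integral>\<^sup>+k. ennreal ((cmod (ft h (real p * of_int k)))\<^sup>2) \<partial>count_space UNIV) = energy lborel h"
        by (rule parseval_interval[OF bh h0]) (use p in auto)
      moreover have "ennreal ((real p)\<^sup>2) = ennreal (real p) * ennreal (real p)"
        by (simp add: power2_eq_square ennreal_mult)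
      ultimately show ?thesis by (simp only: mult.assoc)
    qed
    also have "energy lborel h = energy lborel g"
      by (simp add: energy_def h_def norm_mult)
    finally show ?thesis using g\<mu> G(1) by simp
  qed
  define FS where "FS x = F x * indicator S x" for x
  have G_le: "ennreal G \<le> energy lborel FS"
  proof -
    have "ennreal G = (\<integral>\<^sup>+x. indicator {0..<1::real} x * ennreal G \<partial>lborel)"
      by (simp add: nn_integral_cmult_indicator mult.commute[of "indicator _ _"])
    also have "\<dots> \<le> (\<integral>\<^sup>+x. indicator {0..<1} x * (\<integral>\<^sup>+m. ennreal ((cmod (FS (x + of_int m)))\<^sup>2) \<partial>count_space (UNIV :: int set)) \<partial>lborel)"
    proof (rule nn_integral_mono_AE)
      show "AE x in lborel. indicator {0..<1} x * ennreal G \<le> indicator {0..<1} x * (\<integral>\<^sup>+m. ennreal ((cmod (FS (x + of_int m)))\<^sup>2) \<partial>count_space (UNIV :: int set))"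
        using full
      proof eventually_elim
        case (elim x)
        then obtain j where j: "\<And>k::int. x - real j + real p * of_int k \<in> S"
          unfolding full_fibre_def by blast
        have "ennreal G = (\<integral>\<^sup>+k. ennreal ((cmod (F ((x - real j) + real p * of_int k)))\<^sup>2) \<partial>count_space (UNIV :: int set))"
          by (rule fibre[symmetric])
        also have "\<dots> = (\<integral>\<^sup>+k. ennreal ((cmod (FS (x + of_int (int p * k - int j))))\<^sup>2) \<partial>count_space (UNIV :: int set))"
        proof (rule nn_integral_cong)
          fix k :: int
          have "x + of_int (int p * k - int j) = x - real j + real p * of_int k" by simp
          then show "ennreal ((cmod (F ((x - real j) + real p * of_int k)))\<^sup>2) = ennreal ((cmod (FS (x + of_int (int p * k - int j))))\<^sup>2)"
            using j[of k] by (simp only: FS_def) simp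
        qed
        also have "\<dots> \<le> (\<integral>\<^sup>+m. ennreal ((cmod (FS (x + of_int m)))\<^sup>2) \<partial>count_space (UNIV :: int set))"
          using p by (intro nn_integral_int_reindex_le) (auto intro: injI)
        finally show ?case by (intro mult_left_mono) auto
      qed
    qed
    also have "\<dots> = energy lborel FS"
      unfolding energy_def by (rule nn_integral_fold_unit[symmetric]) (simp add: FS_def)
    finally show ?thesis .
  qed
  have "energy lborel FS = (SUP R. energy lborel (f R))"
  proof -
    have "ennreal ((cmod (FS x))\<^sup>2) = (SUP R. ennreal ((cmod (f R x))\<^sup>2))" for x
    proof (rule antisym)
      obtain R where R: "\<bar>x\<bar> \<le> real R" using real_arch_simple by blast
      then have "f R x = FS x" by (auto simp: f_def FS_def indicator_def abs_le_iff)
      then show "ennreal ((cmod (FS x))\<^sup>2) \<le> (SUP R. ennreal ((cmod (f R x))\<^sup>2))"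
        by (intro SUP_upper2[of R]) auto
      show "(SUP R. ennreal ((cmod (f R x))\<^sup>2)) \<le> ennreal ((cmod (FS x))\<^sup>2)"
        by (rule SUP_least) (auto simp: f_def FS_def indicator_def)
    qed
    moreover have "incseq (\<lambda>R x. ennreal ((cmod (f R x))\<^sup>2))"
      by (auto simp: incseq_def le_fun_def f_def indicator_def)
    moreover have "(\<lambda>x. ennreal ((cmod (f R x))\<^sup>2)) \<in> borel_measurable lborel" for R
      using bounded_supported_borel[OF bf[of R]] by simp
    ultimately show ?thesis
      unfolding energy_def by (simp add: nn_integral_monotone_convergence_SUP)
  qed
  with G_le have sup: "ennreal G \<le> (SUP R. ennreal (a R))" by (simp add: a(1))
  have "\<exists>R. G - a R < \<epsilon>"
  proof (rule ccontr)
    assume "\<not> (\<exists>R. G - a R < \<epsilon>)"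
    then have le: "a R \<le> G - \<epsilon>" for R by (metis linorder_not_less le_diff_eq add.commute)
    then have "(SUP R. ennreal (a R)) \<le> ennreal (G - \<epsilon>)" by (intro SUP_least ennreal_leI)
    with sup have "ennreal G \<le> ennreal (G - \<epsilon>)" by (rule order_trans)
    moreover have "0 \<le> G - \<epsilon>" using le[of 0] a(2)[of 0] by linarith
    ultimately show False using \<epsilon> by (simp add: ennreal_le_iff)
  qed
  then obtain R where "G - a R < \<epsilon>" by blast
  then have "energy ?\<mu> (\<lambda>t. ft (f R) t - g t) < ennreal \<epsilon>"
    unfolding distance using \<epsilon> by (intro ennreal_lessI)
  then show "\<exists>f. admissible S f \<and> energy ?\<mu> (\<lambda>t. ft f t - g t) < ennreal \<epsilon>"
    using af by blast
qed

text \<open>Almost everywhere with respect to the measure, \<open>g\<close> is the limit of its truncations to finitely many cells,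
  each of which is a sum of functions on single cells.\<close>

lemma full_fibres_imp_complete:
  assumes p: "p \<ge> 2" and Sb: "S \<in> sets borel" and sep: "residue_separated p S"
    and full: "AE x in lborel. full_fibre p S x"
    and g: "g \<in> borel_measurable borel" and fin: "energy (periodic_interval_measure p) g < \<infinity>"
  shows "approximable p S g"
proof -
  let ?\<mu> = "periodic_interval_measure p"
  note g[measurable]
  define h where "h N n t = (if cmod (g t) \<le> real N \<and> t - of_int n \<in> cell p then g t else 0)" for N :: nat and n :: int and t
  define u where "u N t = (\<Sum>n\<in>{- int N..int N}. h N n t)" for N t
  define g' where "g' t = g t * indicator (cells p) t" for t
  have hb: "bounded_supported (h N n)" for N n
  proof (rule bounded_supportedI[where B = "real N" and R = "\<bar>of_int n\<bar> + 1"])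
    show "h N n \<in> borel_measurable borel" unfolding h_def[abs_def] by measurable
    show "cmod (h N n t) \<le> real N" for t by (simp add: h_def)
    show "\<bar>t\<bar> \<le> \<bar>of_int n\<bar> + 1" if "h N n t \<noteq> 0" for t
    proof -
      have "t - of_int n \<in> cell p" using that by (simp add: h_def split: if_splits)
      moreover have "1 / (2 * real p) \<le> 1" using p by (simp add: field_simps)
      ultimately show ?thesis unfolding cell_def by auto
    qed
  qed
  note [measurable] = bounded_supported_borel[OF hb]
  have u_approx: "approximable p S (u N)" for N
    unfolding u_def
    by (intro approximable_sum approximable_single_cell[OF p Sb sep full hb]) (auto simp: h_def)
  have [measurable]: "u N \<in> borel_measurable borel" for N unfolding u_def by measurable
  have [measurable]: "g' \<in> borel_measurable borel" unfolding g'_def by measurable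
  have u_cell: "u N t = (if cmod (g t) \<le> real N \<and> \<bar>n\<bar> \<le> int N then g t else 0)" if n: "t - of_int n \<in> cell p" for N t n
  proof -
    have "t - of_int m \<in> cell p \<longleftrightarrow> m = n" for m
      using cell_disjoint[OF p n, of "n - m"] n by auto
    then have "h N m t = (if m = n then (if cmod (g t) \<le> real N then g t else 0) else 0)" for m
      by (simp add: h_def)
    then show ?thesis unfolding u_def by (auto simp: abs_le_iff)
  qed
  have u_out: "u N t = 0" if "t \<notin> cells p" for N t
    using that unfolding u_def h_def cells_def by (auto intro!: sum.neutral)
  have u_cases: "u N t = g' t \<or> u N t = 0" for N t
  proof (cases "t \<in> cells p")
    case True
    then obtain n :: int where "t - of_int n \<in> cell p" unfolding cells_def by blast
    then show ?thesis using True by (simp add: u_cell g'_def)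
  qed (simp add: u_out)
  have u_lim: "(\<lambda>N. u N t) \<longlonglongrightarrow> g' t" for t
  proof (cases "t \<in> cells p")
    case True
    then obtain n :: int where n: "t - of_int n \<in> cell p" unfolding cells_def by blast
    obtain K where K: "cmod (g t) \<le> real K" "\<bar>n\<bar> \<le> int K"
      by (metis max.bounded_iff real_arch_simple of_nat_mono order_trans nat_le_iff of_nat_le_iff max.cobounded1 max.cobounded2)
    have "\<forall>\<^sub>F N in sequentially. u N t = g' t"
      unfolding eventually_sequentially u_cell[OF n] using K True
      by (intro exI[of _ K]) (auto simp: g'_def)
    then show ?thesis by (rule tendsto_eventually)
  qed (simp add: u_out g'_def)
  have "energy ?\<mu> g' = energy ?\<mu> g"
    by (rule energy_periodic_interval_measure_cong) (auto simp: g'_def)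
  then have "(\<lambda>N. energy ?\<mu> (\<lambda>t. u N t - g' t)) \<longlonglongrightarrow> energy ?\<mu> (\<lambda>t. g' t - g' t)"
  proof (intro energy_tendsto[where w = g'])
    show "(\<lambda>N. u N t - g' t) \<longlonglongrightarrow> g' t - g' t" for t
      by (intro tendsto_intros u_lim)
    show "cmod (u N t - g' t) \<le> cmod (g' t)" for N t
      using u_cases[of N t] by auto
  qed (use fin in auto)
  moreover have "energy ?\<mu> (\<lambda>t. u N t - g' t) = energy ?\<mu> (\<lambda>t. u N t - g t)" for N
    by (rule energy_periodic_interval_measure_cong) (auto simp: g'_def)
  ultimately have lim: "(\<lambda>N. energy ?\<mu> (\<lambda>t. u N t - g t)) \<longlonglongrightarrow> 0"
    by (simp add: energy_def)
  show ?thesis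
  proof (rule approximable_limit[OF g])
    fix \<epsilon> :: real assume "\<epsilon> > 0"
    then have "\<forall>\<^sub>F N in sequentially. energy ?\<mu> (\<lambda>t. u N t - g t) < ennreal \<epsilon>"
      by (intro order_tendstoD(2)[OF lim]) simp
    then obtain N where "energy ?\<mu> (\<lambda>t. u N t - g t) < ennreal \<epsilon>"
      by (auto simp: eventually_sequentially)
    then show "\<exists>h. h \<in> borel_measurable borel \<and> approximable p S h \<and> energy ?\<mu> (\<lambda>t. h t - g t) < ennreal \<epsilon>"
      using u_approx[of N] by (intro exI[of _ "u N"]) simp
  qed
qed

section \<open>The equivalence\<close>

theorem theorem1p8:
  fixes \<Omega> :: "real set" and p :: nat
  assumes "open \<Omega>" and "p \<ge> 2"
  shows "tiles \<Omega> (real ` {0..<p}) UNIV \<longleftrightarrow> spectral_pair \<Omega> (periodic_interval_measure p)"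
proof -
  have \<Omega>: "\<Omega> \<in> sets borel" using assms(1) by simp
  show ?thesis
    unfolding spectral_pair_iff[OF \<Omega>]
  proof (intro iffI conjI allI impI; (elim conjE)?)
    assume t: "tiles \<Omega> (real ` {0..<p}) UNIV"
    note tiling = tiles_interval_imp[OF assms(2,1) t]
    show "isometric_on p \<Omega>"
      unfolding isometric_on_def using isometry[OF assms(2) tiling(1)] by blast
    show "approximable p \<Omega> g"
      if "g \<in> borel_measurable borel" "energy (periodic_interval_measure p) g < \<infinity>" for g
      using that by (rule full_fibres_imp_complete[OF assms(2) \<Omega> tiling])
  next
    assume iso: "isometric_on p \<Omega>"
      and dense: "\<forall>g. g \<in> borel_measurable borel \<longrightarrow> energy (periodic_interval_measure p) g < \<infinity> \<longrightarrow> approximable p \<Omega> g"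
    show "tiles \<Omega> (real ` {0..<p}) UNIV"
      using isometric_on_open_imp_residue_separated[OF assms(2,1) iso] dense
      by (intro complete_imp_tiles[OF assms(2,1)]) blast+
  qed
qed

end
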